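(* Let $K$ be an arbitrary field, $x=(x_1,\ldots,x_n)$, and let $M\in\operatorname{Mat}_{m,n}(K[x])$ be a matrix whose entries are polynomials of degree at most $1$ over $K$. Suppose that $\operatorname{rk} M=2$. Then $M$ is equivalent over $K$ to a matrix $\tilde M$ for which one of the following holds: (1) only the first two columns of $\tilde M$ are nonzero (all other columns are zero); (2) only the first two rows of $\tilde M$ are nonzero (all other rows are zero); (3) the first row and the first column of $\tilde M$ are nonzero, and $\tilde M$ is zero elsewhere; (4) the leading principal $3\times3$ minor matrix of $\tilde M$ is antisymmetric with only zeroes on the diagonal, and $\tilde M$ is zero elsewhere; furthermore, the three entries below the diagonal of this $3\times 3$ matrix are linearly independent over $K$. If, in addition, $M$ is the Jacobian matrix of a polynomial map, then $\tilde M$ can be chosen such that one of (1), (2), (3), (4) holds, where the following assertions are added to (3) and (4) respectively: in (3): the first column of $\tilde M$ is of the form $( *,*,\tfrac12,0,\ldots,0)$ (in particular $\tfrac12\in K$); in (4): $\tilde M$ is symmetric, i.e. $\tfrac12\notin K$.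
   Context: $\operatorname{Mat}_{m,n}(R)$ denotes the $m\times n$ matrices over $R$. The rank $\operatorname{rk} M$ of $M\in\operatorname{Mat}_{m,n}(K[x])$ is its rank over the field of fractions $K(x)$. Two matrices $M,\tilde M\in\operatorname{Mat}_{m,n}(K[x])$ are equivalent over $K$ if there exist $S\in\operatorname{GL}_m(K)$ and $T\in\operatorname{GL}_n(K)$ with $\tilde M=SMT$. The leading principal $3\times 3$ minor matrix is the upper left $3\times 3$ submatrix. A square matrix $A$ is symmetric if $A^{\rm t}=A$ and antisymmetric if $A^{\rm t}=-A$. A polynomial map $H=(H_1,\ldots,H_m)\in K[x]^m$ has Jacobian matrix $\mathcal{J}H=\left(\frac{\partial H_i}{\partial x_j}\right)_{1\le i\le m,\,1\le j\le n}$; a matrix is the Jacobian matrix of a polynomial map if it equals $\mathcal{J}H$ for some $H\in K[x]^m$. The notation $( *,*,\tfrac12,0,\ldots,0)$ means: the first two entries are arbitrary, the third entry is the constant $\tfrac12\in K$, and all further entries are zero. $\tfrac12\in K$ means that the characteristic of $K$ is not $2$. In case (4), the symmetry of $\tilde M$ refers to its leading principal $3\times3$ minor matrix, outside of which $\tilde M$ is zero. *)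

theory Defs
  imports
    "HOL-Library.Poly_Mapping"
    "HOL-Computational_Algebra.Polynomial_Factorial"
    "Jordan_Normal_Form.DL_Rank"
begin

text \<open>
  The elements of type \<open>'v\<close> are the variables. The polynomial ring \<open>K[x]\<close> over \<open>'k\<close> consists of the
  finitely supported maps from exponent vectors to coefficients, so that
  \<open>Poly_Mapping.lookup p t\<close> is the coefficient of the monomial \<open>t\<close> in \<open>p\<close>. Its multiplication does
  not depend on the order on \<open>'v\<close>; the library only uses that order to prove that the ring is an
  integral domain, which is needed to form \<open>K(x)\<close>.
\<close>

type_synonym ('v, 'k) mpol = "('v \<Rightarrow>\<^sub>0 nat) \<Rightarrow>\<^sub>0 'k"

definition const_mpol :: "'k::zero \<Rightarrow> ('v, 'k) mpol" where
  "const_mpol c = Poly_Mapping.single 0 c"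

text \<open>The zero polynomial gets degree \<open>0\<close>.\<close>

definition total_deg :: "('v, 'k::zero) mpol \<Rightarrow> nat" where
  "total_deg p = Max (insert 0
     ((\<lambda>t. \<Sum>v\<in>Poly_Mapping.keys t. Poly_Mapping.lookup t v) ` Poly_Mapping.keys p))"

text \<open>
  Termwise differentiation. Subtraction of exponents is truncated, but where it truncates, the
  factor \<open>of_nat (Poly_Mapping.lookup t v)\<close> is \<open>0\<close>.
\<close>

definition partial_deriv :: "'v \<Rightarrow> ('v, 'k::comm_semiring_1) mpol \<Rightarrow> ('v, 'k) mpol" where
  "partial_deriv v p = (\<Sum>t\<in>Poly_Mapping.keys p.
     Poly_Mapping.single (t - Poly_Mapping.single v 1)
       (of_nat (Poly_Mapping.lookup t v) * Poly_Mapping.lookup p t))"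

text \<open>
  In the following, \<open>x 0, \<dots>, x (n - 1)\<close> are the variables. Rows and columns are numbered
  from \<open>0\<close>.
\<close>

definition jacobian_mat ::
    "(nat \<Rightarrow> 'v) \<Rightarrow> nat \<Rightarrow> ('v, 'k::comm_semiring_1) mpol vec \<Rightarrow> ('v, 'k) mpol mat" where
  "jacobian_mat x n H = mat (dim_vec H) n (\<lambda>(i, j). partial_deriv (x j) (H $ i))"

definition is_jacobian_mat ::
    "(nat \<Rightarrow> 'v) \<Rightarrow> ('v, 'k::comm_semiring_1) mpol mat \<Rightarrow> bool" where
  "is_jacobian_mat x M \<longleftrightarrow>
     (\<exists>H \<in> carrier_vec (dim_row M). M = jacobian_mat x (dim_col M) H)"

text \<open>The rank over the field of fractions \<open>K(x)\<close>.\<close>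

definition mpol_rank :: "('v::linorder, 'k::field) mpol mat \<Rightarrow> nat" where
  "mpol_rank M = vec_space.rank (dim_row M) (map_mat to_fract M)"

definition equivalent_over_K ::
    "('v, 'k::field) mpol mat \<Rightarrow> ('v, 'k) mpol mat \<Rightarrow> bool" where
  "equivalent_over_K M N \<longleftrightarrow>
     (\<exists>S \<in> carrier_mat (dim_row M) (dim_row M). \<exists>T \<in> carrier_mat (dim_col M) (dim_col M).
        invertible_mat S \<and> invertible_mat T \<and>
        N = map_mat const_mpol S * M * map_mat const_mpol T)"

definition only_first_two_cols :: "'a::zero mat \<Rightarrow> bool" where
  "only_first_two_cols N \<longleftrightarrow> {j. j < dim_col N \<and> col N j \<noteq> 0\<^sub>v (dim_row N)} = {0, 1}"

definition only_first_two_rows :: "'a::zero mat \<Rightarrow> bool" where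
  "only_first_two_rows N \<longleftrightarrow> {i. i < dim_row N \<and> row N i \<noteq> 0\<^sub>v (dim_col N)} = {0, 1}"

definition only_first_row_and_col :: "'a::zero mat \<Rightarrow> bool" where
  "only_first_row_and_col N \<longleftrightarrow>
     0 < dim_row N \<and> 0 < dim_col N \<and>
     row N 0 \<noteq> 0\<^sub>v (dim_col N) \<and> col N 0 \<noteq> 0\<^sub>v (dim_row N) \<and>
     (\<forall>i < dim_row N. \<forall>j < dim_col N. i \<noteq> 0 \<and> j \<noteq> 0 \<longrightarrow> N $$ (i, j) = 0)"

definition leading3 :: "'a mat \<Rightarrow> 'a mat" where
  "leading3 N = mat 3 3 (\<lambda>(i, j). N $$ (i, j))"

definition antisymmetric_mat :: "'a::uminus mat \<Rightarrow> bool" where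
  "antisymmetric_mat A \<longleftrightarrow> transpose_mat A = - A"

definition symmetric_mat :: "'a mat \<Rightarrow> bool" where
  "symmetric_mat A \<longleftrightarrow> transpose_mat A = A"

definition lin_indep3 ::
    "('v, 'k::field) mpol \<Rightarrow> ('v, 'k) mpol \<Rightarrow> ('v, 'k) mpol \<Rightarrow> bool" where
  "lin_indep3 p q r \<longleftrightarrow>
     (\<forall>a b c. const_mpol a * p + const_mpol b * q + const_mpol c * r = 0 \<longrightarrow>
        a = 0 \<and> b = 0 \<and> c = 0)"

definition only_antisymmetric_leading3 :: "('v, 'k::field) mpol mat \<Rightarrow> bool" where
  "only_antisymmetric_leading3 N \<longleftrightarrow>
     3 \<le> dim_row N \<and> 3 \<le> dim_col N \<and>
     antisymmetric_mat (leading3 N) \<and> (\<forall>i < 3. leading3 N $$ (i, i) = 0) \<and>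
     (\<forall>i < dim_row N. \<forall>j < dim_col N. \<not> (i < 3 \<and> j < 3) \<longrightarrow> N $$ (i, j) = 0) \<and>
     lin_indep3 (leading3 N $$ (1, 0)) (leading3 N $$ (2, 0)) (leading3 N $$ (2, 1))"

text \<open>
  The first column is \<open>(*, *, 1/2, 0, \<dots>, 0)\<close>. In characteristic \<open>2\<close>, the term \<open>1 / 2\<close> denotes \<open>0\<close>
  by convention, so \<open>1/2 \<in> K\<close> has to be required explicitly.
\<close>

definition first_col_half :: "('v, 'k::field) mpol mat \<Rightarrow> bool" where
  "first_col_half N \<longleftrightarrow>
     CHAR('k) \<noteq> 2 \<and> 3 \<le> dim_row N \<and> N $$ (2, 0) = const_mpol (1 / 2) \<and>
     (\<forall>i < dim_row N. 3 \<le> i \<longrightarrow> N $$ (i, 0) = 0)"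

end

theory Submission
  imports Defs
begin

text \<open>
  Write the entries of \<open>M\<close> as homogeneous linear forms in \<open>1, x\<^sub>0, \<dots>, x\<^bsub>n-1\<^esub>\<close>. A nonzero \<open>2 \<times> 2\<close>
  minor is a quadratic form, so it is nonzero at some point \<open>a\<close> over \<open>K\<close>, even if \<open>K\<close> is finite.
  Reduce \<open>M(a)\<close> to \<open>diag(1, 1, 0, \<dots>, 0)\<close>. Since all \<open>3 \<times> 3\<close> minors of \<open>M + t M(a)\<close> vanish, \<open>M\<close> has the
  block form \<open>(A B; C 0)\<close> with \<open>C B = 0\<close>, where \<open>C\<close> has two columns and \<open>B\<close> has two rows. If \<open>B = 0\<close>
  or \<open>C = 0\<close>, this is case (1) or (2). If some nonzero row of \<open>C\<close> has linearly dependent entries, all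
  rows of \<open>C\<close> and columns of \<open>B\<close> satisfy a common dependency, which leads to case (3). Otherwise every
  row of \<open>C\<close> is a multiple of one row \<open>(p, q)\<close>, every column of \<open>B\<close> is a multiple of \<open>(-q, p)\<close>, and the
  remaining \<open>3 \<times> 3\<close> determinant forces the antisymmetric shape.

  For the Jacobian matrix of a polynomial map and \<open>N = S M T\<close>, the derivative of \<open>N\<^bsub>ij\<^esub>\<close> in the direction of the
  \<open>l\<close>-th column of \<open>T\<close> is symmetric in \<open>j\<close> and \<open>l\<close>, and alternating in characteristic \<open>2\<close>; the
  additional assertions follow from this.
\<close>

section \<open>Affine polynomials and polarization\<close>

lemma const_mpol_0 [simp]: "const_mpol 0 = 0"
  by (simp add: const_mpol_def)

lemma const_mpol_1 [simp]: "const_mpol 1 = 1"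
  by (simp add: const_mpol_def)

lemma const_mpol_add: "const_mpol (a + b) = const_mpol a + const_mpol b"
  by (simp add: const_mpol_def single_add)

lemma const_mpol_uminus: "const_mpol (- a :: 'k::comm_ring_1) = - const_mpol a"
  by (simp add: const_mpol_def single_uminus)

lemma const_mpol_mult: "const_mpol (a * b) = const_mpol a * (const_mpol b :: ('v, 'k::comm_semiring_1) mpol)"
  by (simp add: const_mpol_def mult_single)

lemma const_mpol_eq_0_iff [simp]: "const_mpol a = 0 \<longleftrightarrow> a = 0"
  by (metis const_mpol_def const_mpol_0 lookup_single_eq lookup_zero)

lemma const_mpol_sum: "const_mpol (sum f A) = (\<Sum>i\<in>A. const_mpol (f i))"
  by (induction A rule: infinite_finite_induct) (auto simp: const_mpol_add)

lemma lookup_const_mult [simp]: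
  "Poly_Mapping.lookup (const_mpol c * p) t = c * Poly_Mapping.lookup p (t :: 'v \<Rightarrow>\<^sub>0 nat)"
  for p :: "('v, 'k::comm_semiring_1) mpol"
proof -
  have "const_mpol c * p = Poly_Mapping.map ((*) c) p"
    by (simp add: const_mpol_def mult_map_scale_conv_mult)
  thus ?thesis by (simp add: Poly_Mapping.map.rep_eq when_def)
qed

text \<open>The exponents of the monomials 1 and \<open>x_v\<close>. Phrasing degree at most 1
  through the support makes closure under linear combinations a statement about single
  coefficients.\<close>

definition aff_exps :: "('v \<Rightarrow>\<^sub>0 nat) set" where
  "aff_exps = insert 0 (range (\<lambda>v. Poly_Mapping.single v 1))"

definition aff :: "('v, 'k::zero) mpol \<Rightarrow> bool" where
  "aff p \<longleftrightarrow> Poly_Mapping.keys p \<subseteq> aff_exps"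

text \<open>Every key of an exponent contributes at least 1 to its total, so a total of at most 1
  leaves room for one key, and for that one only with exponent 1.\<close>

lemma aff_if_total_deg_le_1:
  fixes p :: "('v, 'k::zero) mpol"
  assumes "total_deg p \<le> 1"
  shows "aff p"
  unfolding aff_def
proof
  fix t assume t: "t \<in> Poly_Mapping.keys p"
  define d where "d = (\<Sum>v\<in>Poly_Mapping.keys t. Poly_Mapping.lookup t v)"
  have "d \<le> 1"
    using assms t unfolding total_deg_def d_def by (subst (asm) Max_le_iff) auto
  show "t \<in> aff_exps"
  proof (cases "t = 0")
    case False
    then obtain v where v: "v \<in> Poly_Mapping.keys t"
      by (metis keys_eq_empty ex_in_conv)
    have ge: "1 \<le> Poly_Mapping.lookup t w" if "w \<in> Poly_Mapping.keys t" for w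
      using that by (simp add: in_keys_iff Suc_leI)
    have d: "d = Poly_Mapping.lookup t v + (\<Sum>v\<in>Poly_Mapping.keys t - {v}. Poly_Mapping.lookup t v)"
      unfolding d_def using v by (simp add: sum.remove)
    have "Poly_Mapping.lookup t v = 1" "(\<Sum>v\<in>Poly_Mapping.keys t - {v}. Poly_Mapping.lookup t v) = 0"
      using d ge[OF v] \<open>d \<le> 1\<close> by linarith+
    hence "Poly_Mapping.lookup t w = (1 when v = w)" for w
      by (cases "w = v") (auto simp: in_keys_iff)
    hence "t = Poly_Mapping.single v 1"
      by (intro poly_mapping_eqI) (simp add: lookup_single)
    thus ?thesis by (simp add: aff_exps_def)
  qed (simp add: aff_exps_def)
qed

lemma aff_iff: "aff p \<longleftrightarrow> (\<forall>t. t \<notin> aff_exps \<longrightarrow> Poly_Mapping.lookup p t = 0)"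
  unfolding aff_def by (auto simp: in_keys_iff subset_iff)

lemma aff_add: "aff p \<Longrightarrow> aff q \<Longrightarrow> aff (p + q)"
  by (simp add: aff_iff lookup_add)

lemma aff_uminus: "aff p \<Longrightarrow> aff (- p)" for p :: "('v, 'k::comm_ring_1) mpol"
  by (simp add: aff_iff)

lemma aff_const_mult: "aff p \<Longrightarrow> aff (const_mpol c * p)" for p :: "('v, 'k::comm_ring_1) mpol"
  by (simp add: aff_iff)

lemma aff_diff: "aff p \<Longrightarrow> aff q \<Longrightarrow> aff (p - q)" for p :: "('v, 'k::comm_ring_1) mpol"
  by (simp add: aff_iff lookup_minus)

text \<open>For affine \<open>p\<close>, the evaluation of the homogenization of \<open>p\<close> at a point \<open>a\<close>, whose homogenizing
  coordinate is \<open>a 0\<close> and whose \<open>v\<close>-coordinate is \<open>a (Poly_Mapping.single v 1)\<close>.\<close>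

definition ev :: "(('v \<Rightarrow>\<^sub>0 nat) \<Rightarrow> 'k) \<Rightarrow> ('v, 'k::comm_ring_1) mpol \<Rightarrow> 'k" where
  "ev a p = (\<Sum>t\<in>Poly_Mapping.keys p. a t * Poly_Mapping.lookup p t)"

lemma ev_superset:
  assumes "finite A" "Poly_Mapping.keys p \<subseteq> A"
  shows "ev a p = (\<Sum>t\<in>A. a t * Poly_Mapping.lookup p t)"
  unfolding ev_def using assms by (intro sum.mono_neutral_left) (auto simp: in_keys_iff)

lemma ev_0 [simp]: "ev a 0 = 0"
  by (simp add: ev_def)

lemma ev_add: "ev a (p + q) = ev a p + ev a q"
proof -
  let ?A = "Poly_Mapping.keys p \<union> Poly_Mapping.keys q"
  have "ev a (p + q) = (\<Sum>t\<in>?A. a t * Poly_Mapping.lookup (p + q) t)"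
    "ev a p = (\<Sum>t\<in>?A. a t * Poly_Mapping.lookup p t)"
    "ev a q = (\<Sum>t\<in>?A. a t * Poly_Mapping.lookup q t)"
    by (intro ev_superset; use keys_add in force)+
  thus ?thesis by (simp add: lookup_add algebra_simps sum.distrib)
qed

lemma ev_const_mult: "ev a (const_mpol c * p) = c * ev a p"
proof -
  have "Poly_Mapping.keys (const_mpol c * p) \<subseteq> Poly_Mapping.keys p"
    by (auto simp: in_keys_iff)
  thus ?thesis
    by (subst ev_superset[of "Poly_Mapping.keys p"])
       (auto simp: ev_def sum_distrib_left mult.left_commute)
qed

lemma ev_uminus: "ev a (- p) = - ev a p"
  using ev_const_mult[of a "-1" p] by (simp add: const_mpol_uminus)

lemma ev_sum: "ev a (sum f A) = (\<Sum>i\<in>A. ev a (f i))"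
  by (induction A rule: infinite_finite_induct) (auto simp: ev_add)

text \<open>For an infinite type of variables, every product below is \<open>1\<close> by convention.\<close>

definition insertion :: "('k \<Rightarrow> 'r) \<Rightarrow> ('v \<Rightarrow> 'r) \<Rightarrow> ('v, 'k::comm_ring_1) mpol \<Rightarrow> 'r::comm_ring_1" where
  "insertion h f p = (\<Sum>t\<in>Poly_Mapping.keys p.
     h (Poly_Mapping.lookup p t) * (\<Prod>v\<in>UNIV. f v ^ Poly_Mapping.lookup t v))"

lemma insertion_0: "insertion h f 0 = 0"
  by (simp add: insertion_def)

section \<open>Substitution as a ring homomorphism\<close>

lemma sum_monomials:
  fixes p :: "'a \<Rightarrow>\<^sub>0 'b::comm_monoid_add"
  shows "p = (\<Sum>t\<in>Poly_Mapping.keys p. Poly_Mapping.single t (Poly_Mapping.lookup p t))"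
proof (rule poly_mapping_eqI)
  fix k
  show "Poly_Mapping.lookup p k = Poly_Mapping.lookup
    (\<Sum>t\<in>Poly_Mapping.keys p. Poly_Mapping.single t (Poly_Mapping.lookup p t)) k"
    by (cases "k \<in> Poly_Mapping.keys p")
       (auto simp: lookup_sum lookup_single when_def in_keys_iff)
qed

context
  fixes h :: "'k::comm_ring_1 \<Rightarrow> 'r::comm_ring_1"
  assumes h0: "h 0 = 0" and h1: "h 1 = 1"
    and h_add: "\<And>a b. h (a + b) = h a + h b"
    and h_mult: "\<And>a b. h (a * b) = h a * h b"
begin

lemma insertion_superset:
  assumes "finite A" "Poly_Mapping.keys p \<subseteq> A"
  shows "insertion h f p = (\<Sum>t\<in>A. h (Poly_Mapping.lookup p t) * (\<Prod>v\<in>UNIV. f v ^ Poly_Mapping.lookup t v))"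
  unfolding insertion_def using assms
  by (intro sum.mono_neutral_left) (auto simp: in_keys_iff h0)

lemma insertion_add: "insertion h f (p + q) = insertion h f p + insertion h f q"
proof -
  let ?A = "Poly_Mapping.keys p \<union> Poly_Mapping.keys q"
  have "insertion h f r = (\<Sum>t\<in>?A. h (Poly_Mapping.lookup r t) * (\<Prod>v\<in>UNIV. f v ^ Poly_Mapping.lookup t v))"
    if "r \<in> {p, q, p + q}" for r
    using that by (intro insertion_superset) (use keys_add in force)+
  thus ?thesis by (simp add: lookup_add h_add algebra_simps sum.distrib)
qed

lemma insertion_sum: "insertion h f (sum g A) = (\<Sum>i\<in>A. insertion h f (g i))"
  by (induction A rule: infinite_finite_induct) (auto simp: insertion_0 insertion_add)

lemma insertion_single:
  "insertion h f (Poly_Mapping.single t c) = h c * (\<Prod>v\<in>UNIV. f v ^ Poly_Mapping.lookup t v)"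
  by (subst insertion_superset[of "{t}"]) auto

text \<open>On monomials this is additivity of exponents together with multiplicativity of
  \<open>h\<close>; both factors are expanded into monomials and the double sums compared.\<close>

lemma insertion_mult: "insertion h f (p * q) = insertion h f p * insertion h f q"
proof -
  let ?s = "\<lambda>p t. Poly_Mapping.single t (Poly_Mapping.lookup p t)"
  have single: "insertion h f (Poly_Mapping.single t c * Poly_Mapping.single u d) =
    insertion h f (Poly_Mapping.single t c) * insertion h f (Poly_Mapping.single u d)" for t u c d
    by (simp add: mult_single insertion_single h_mult lookup_add power_add prod.distrib algebra_simps)
  have "p * q = (\<Sum>t\<in>Poly_Mapping.keys p. \<Sum>u\<in>Poly_Mapping.keys q. ?s p t * ?s q u)"
    by (subst sum_monomials[of p], subst sum_monomials[of q]) (rule sum_product)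
  hence "insertion h f (p * q) = (\<Sum>t\<in>Poly_Mapping.keys p. \<Sum>u\<in>Poly_Mapping.keys q.
      insertion h f (?s p t) * insertion h f (?s q u))"
    by (simp add: insertion_sum single)
  also have "\<dots> = insertion h f (\<Sum>t\<in>Poly_Mapping.keys p. ?s p t) *
      insertion h f (\<Sum>u\<in>Poly_Mapping.keys q. ?s q u)"
    by (simp add: insertion_sum sum_product)
  finally show ?thesis by (simp flip: sum_monomials)
qed

end

text \<open>With a new variable t, this is p + t * \<open>ev a p\<close>. For affine
  \<open>p\<close> it is the homogenization of \<open>p\<close> taken at (1, x) + t a, so comparing
  powers of t in an identity between lifts polarizes that identity.\<close>

definition lift :: "(('v \<Rightarrow>\<^sub>0 nat) \<Rightarrow> 'k) \<Rightarrow> ('v, 'k::field) mpol \<Rightarrow> ('v, 'k) mpol poly" where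
  "lift a p = [:p, const_mpol (ev a p):]"

text \<open>The substitution \<open>x\<^sub>v \<mapsto> (x\<^sub>v + t a\<^sub>v) / (1 + t a\<^sub>0)\<close>: after clearing the denominator it moves
  homogeneous identities between affine polynomials from \<open>x\<close> to \<open>x + t a\<close>.\<close>

lemma shift_hom:
  fixes a :: "('v::linorder \<Rightarrow>\<^sub>0 nat) \<Rightarrow> 'k::field"
  assumes fin: "finite (UNIV :: 'v set)"
  obtains \<Psi> :: "('v, 'k) mpol \<Rightarrow> ('v, 'k) mpol poly fract" and s where
    "\<Psi> 0 = 0" "\<And>p q. \<Psi> (p + q) = \<Psi> p + \<Psi> q" "\<And>p q. \<Psi> (p - q) = \<Psi> p - \<Psi> q"
    "\<And>p q. \<Psi> (p * q) = \<Psi> p * \<Psi> q" "\<And>p. aff p \<Longrightarrow> to_fract (lift a p) = s * \<Psi> p"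
proof
  let ?h = "\<lambda>c. to_fract [:const_mpol c :: ('v, 'k) mpol:]"
  \<comment> \<open>For an exponent \<open>t\<close>, \<open>?l t\<close> is the lift of that
    monomial. The value \<open>?l 0\<close> is the common denominator of the substitution and serves
    as the scaling factor \<open>s\<close>.\<close>
  let ?l = "\<lambda>t. to_fract [:Poly_Mapping.single t 1 :: ('v, 'k) mpol, const_mpol (a t):]"
  let ?f = "\<lambda>v. ?l (Poly_Mapping.single v 1) / ?l 0"
  have h: "?h 0 = 0" "?h 1 = 1" "?h (c + d) = ?h c + ?h d" "?h (c * d) = ?h c * ?h d" for c d
    by (simp_all add: const_mpol_add const_mpol_mult flip: to_fract_add to_fract_mult one_pCons)
  have s: "?l 0 \<noteq> 0" by simp
  show "insertion ?h ?f 0 = 0" by (rule insertion_0)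
  show add: "insertion ?h ?f (p + q) = insertion ?h ?f p + insertion ?h ?f q" for p q
    by (rule insertion_add) (use h in auto)
  show "insertion ?h ?f (p - q) = insertion ?h ?f p - insertion ?h ?f q" for p q
    using add[of "p - q" q] by (simp only: diff_add_cancel eq_diff_eq)
  show "insertion ?h ?f (p * q) = insertion ?h ?f p * insertion ?h ?f q" for p q
    by (rule insertion_mult) (use h in auto)
  fix p :: "('v, 'k) mpol" assume p: "aff p"
  \<comment> \<open>In degree at most 1, a single factor \<open>?l 0\<close> clears the denominator.
    This is where affinity enters.\<close>
  have mon: "?l 0 * (\<Prod>v\<in>UNIV. ?f v ^ Poly_Mapping.lookup t v) = ?l t" if t_in: "t \<in> aff_exps" for t
  proof (cases "t = 0")
    case False
    then obtain v where t: "t = Poly_Mapping.single v 1"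
      using t_in False unfolding aff_exps_def by blast
    have "(\<Prod>w\<in>UNIV. ?f w ^ Poly_Mapping.lookup t w) = (\<Prod>w\<in>UNIV. if w = v then ?f v else 1)"
      by (rule prod.cong) (auto simp: t lookup_single when_def)
    also have "\<dots> = ?f v" using fin by simp
    finally show ?thesis using s t by (simp add: field_simps)
  qed simp
  have scaled: "?h c * ?l t = to_fract [:Poly_Mapping.single t c, const_mpol (a t * c):]" for c t
    by (simp add: const_mpol_def mult_single mult.commute flip: to_fract_mult)
  have "?l 0 * insertion ?h ?f p =
      (\<Sum>t\<in>Poly_Mapping.keys p. ?h (Poly_Mapping.lookup p t) * ?l t)"
    unfolding insertion_def sum_distrib_left
    using p mon by (intro sum.cong) (auto simp: aff_def subset_iff mult.left_commute)
  also have "\<dots> = to_fract (\<Sum>t\<in>Poly_Mapping.keys p.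
      [:Poly_Mapping.single t (Poly_Mapping.lookup p t), const_mpol (a t * Poly_Mapping.lookup p t):])"
    unfolding scaled by (induction rule: infinite_finite_induct) auto
  also have "(\<Sum>t\<in>Poly_Mapping.keys p.
      [:Poly_Mapping.single t (Poly_Mapping.lookup p t), const_mpol (a t * Poly_Mapping.lookup p t):]) =
    [:\<Sum>t\<in>Poly_Mapping.keys p. Poly_Mapping.single t (Poly_Mapping.lookup p t),
      \<Sum>t\<in>Poly_Mapping.keys p. const_mpol (a t * Poly_Mapping.lookup p t):]"
    by (induction rule: infinite_finite_induct) auto
  also have "\<dots> = [:p, const_mpol (ev a p):]"
    by (simp add: ev_def const_mpol_sum flip: sum_monomials)
  finally show "to_fract (lift a p) = ?l 0 * insertion ?h ?f p" by (simp add: lift_def)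
qed

section \<open>Minors and the rank\<close>

text \<open>Row indices come first, column indices last. Minors are taken of functions of two
  indices, so that one definition serves for polynomial entries, their values at a point, their
  lifts and their images in the fraction field.\<close>

definition minor2 :: "(nat \<Rightarrow> nat \<Rightarrow> 'a::comm_ring_1) \<Rightarrow> nat \<Rightarrow> nat \<Rightarrow> nat \<Rightarrow> nat \<Rightarrow> 'a" where
  "minor2 f i k j l = f i j * f k l - f i l * f k j"

definition minor3 ::
    "(nat \<Rightarrow> nat \<Rightarrow> 'a::comm_ring_1) \<Rightarrow> nat \<Rightarrow> nat \<Rightarrow> nat \<Rightarrow> nat \<Rightarrow> nat \<Rightarrow> nat \<Rightarrow> 'a" where
  "minor3 f i k p j l q =
     f i j * (f k l * f p q - f k q * f p l) - f i l * (f k j * f p q - f k q * f p j)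
     + f i q * (f k j * f p l - f k l * f p j)"

definition vanish2 :: "nat \<Rightarrow> nat \<Rightarrow> (nat \<Rightarrow> nat \<Rightarrow> 'a::comm_ring_1) \<Rightarrow> bool" where
  "vanish2 m n f \<longleftrightarrow> (\<forall>i<m. \<forall>k<m. \<forall>j<n. \<forall>l<n. minor2 f i k j l = 0)"

definition vanish3 :: "nat \<Rightarrow> nat \<Rightarrow> (nat \<Rightarrow> nat \<Rightarrow> 'a::comm_ring_1) \<Rightarrow> bool" where
  "vanish3 m n f \<longleftrightarrow>
     (\<forall>i<m. \<forall>k<m. \<forall>p<m. \<forall>j<n. \<forall>l<n. \<forall>q<n. minor3 f i k p j l q = 0)"

lemma vanish2_cong:
  "(\<And>i j. i < m \<Longrightarrow> j < n \<Longrightarrow> f i j = g i j) \<Longrightarrow> vanish2 m n f = vanish2 m n g"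
  by (auto simp: vanish2_def minor2_def)

lemma vanish3_cong:
  "(\<And>i j. i < m \<Longrightarrow> j < n \<Longrightarrow> f i j = g i j) \<Longrightarrow> vanish3 m n f = vanish3 m n g"
  by (auto simp: vanish3_def minor3_def)

lemma vanish2_transpose: "vanish2 n m (\<lambda>i j. f j i) = vanish2 m n f"
proof -
  have "minor2 (\<lambda>i j. f j i) i k j l = minor2 f j l i k" for i j k l
    by (simp add: minor2_def)
  thus ?thesis by (auto simp: vanish2_def)
qed

lemma vanish3_transpose: "vanish3 n m (\<lambda>i j. f j i) = vanish3 m n f"
proof -
  have "minor3 (\<lambda>i j. f j i) i k p j l q = minor3 f j l q i k p" for i k p j l q
    by (simp add: minor3_def algebra_simps)
  thus ?thesis by (auto simp: vanish3_def)
qed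

text \<open>Multilinearity in the rows: the term that takes row \<open>k\<close> twice is a minor
  with two equal rows and cancels, so only multiples of minors of \<open>f\<close> remain. The 3x3
  version is the same.\<close>

lemma vanish2_lincomb:
  assumes "vanish2 m n f" "k < m"
  shows "vanish2 m n (\<lambda>i j. c i * f i j + d i * f k j)"
proof -
  have "minor2 (\<lambda>i j. c i * f i j + d i * f k j) i p j l =
    c i * c p * minor2 f i p j l + c i * d p * minor2 f i k j l + d i * c p * minor2 f k p j l"
    for i p j l by (simp add: minor2_def algebra_simps)
  thus ?thesis using assms by (simp add: vanish2_def)
qed

lemma vanish3_lincomb:
  assumes "vanish3 m n f" "r < m"
  shows "vanish3 m n (\<lambda>i j. c i * f i j + d i * f r j)"
proof -
  have "minor3 (\<lambda>i j. c i * f i j + d i * f r j) i k p j l q =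
    c i * c k * c p * minor3 f i k p j l q + d i * c k * c p * minor3 f r k p j l q
    + c i * d k * c p * minor3 f i r p j l q + c i * c k * d p * minor3 f i k r j l q"
    for i k p j l q by (simp add: minor3_def algebra_simps)
  thus ?thesis using assms by (simp add: vanish3_def)
qed

lemma vanish2_perm:
  "vanish2 m n f \<Longrightarrow> (\<And>i. i < m \<Longrightarrow> \<sigma> i < m) \<Longrightarrow> vanish2 m n (\<lambda>i j. f (\<sigma> i) j)"
  by (simp add: vanish2_def minor2_def)

lemma vanish3_perm:
  "vanish3 m n f \<Longrightarrow> (\<And>i. i < m \<Longrightarrow> \<sigma> i < m) \<Longrightarrow> vanish3 m n (\<lambda>i j. f (\<sigma> i) j)"
  by (simp add: vanish3_def minor3_def)

text \<open>A maximal independent set of columns has two elements \<open>b1\<close>,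
  \<open>b2\<close>. All columns are combinations of them, so the matrix factors through a
  two-dimensional space and its 3x3 minors vanish. If all 2x2 minors vanished too, \<open>b1\<close>
  and \<open>b2\<close> would be dependent.\<close>

lemma (in vec_space) rank_2_minors:
  assumes A: "A \<in> carrier_mat n nc" and rank: "rank A = 2"
  shows "vanish3 n nc (\<lambda>i j. A $$ (i, j))" "\<not> vanish2 n nc (\<lambda>i j. A $$ (i, j))"
proof -
  let ?P = "\<lambda>T. T \<subseteq> set (cols A) \<and> lin_indpt T"
  have cols: "set (cols A) \<subseteq> carrier_vec n" using A cols_dim by blast
  have "?P {}" using finite_lin_indpt2[of "{}"] by auto
  then obtain S where finS: "finite S" and S: "maximal S ?P"
    using maximal_exists_superset[of "set (cols A)" ?P "{}"] by blast
  hence sub: "S \<subseteq> set (cols A)" and li: "lin_indpt S" by (auto simp: maximal_def)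
  have Sc: "S \<subseteq> carrier_vec n" using sub cols by blast
  have "card S = 2" using rank_card_indpt[OF A S] rank by simp
  then obtain b1 b2 where Seq: "S = {b1, b2}" and ne: "b1 \<noteq> b2"
    by (auto simp: card_2_iff)
  have "\<exists>\<alpha> \<beta>. \<forall>i<n. A $$ (i, j) = \<alpha> * b1 $ i + \<beta> * b2 $ i" if j: "j < nc" for j
  proof -
    have mem: "col A j \<in> set (cols A)" using j A by (auto simp: cols_def)
    have span: "col A j \<in> span S"
    proof (cases "col A j \<in> S")
      case True
      thus ?thesis using Sc span_mem by auto
    next
      case False
      have "\<not> lin_indpt (insert (col A j) S)"
        using S mem sub False unfolding maximal_def by blast
      thus ?thesis
        using lin_dep_iff_in_span[OF _ li _ False] Sc mem cols by auto
    qed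
    obtain a where a: "lincomb a S = col A j"
      using finite_in_span[OF finS _ span] Sc by auto
    have "A $$ (i, j) = a b1 * b1 $ i + a b2 * b2 $ i" if "i < n" for i
      using lincomb_index[OF that Sc, of a] A that j ne unfolding a by (simp add: Seq)
    thus ?thesis by blast
  qed
  then obtain \<alpha> \<beta> where AB: "A $$ (i, j) = \<alpha> j * b1 $ i + \<beta> j * b2 $ i" if "i < n" "j < nc" for i j
    by metis
  show "vanish3 n nc (\<lambda>i j. A $$ (i, j))"
    unfolding vanish3_def minor3_def by (auto simp: AB algebra_simps)
  show "\<not> vanish2 n nc (\<lambda>i j. A $$ (i, j))"
  proof
    assume van: "vanish2 n nc (\<lambda>i j. A $$ (i, j))"
    obtain j1 j2 where j: "j1 < nc" "j2 < nc" and b: "b1 = col A j1" "b2 = col A j2"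
      using sub A unfolding Seq by (auto simp: cols_def)
    have min: "b1 $ i * b2 $ k = b2 $ i * b1 $ k" if "i < n" "k < n" for i k
      using van that j A unfolding b vanish2_def minor2_def by auto
    have b1c: "b1 \<in> carrier_vec n" "b2 \<in> carrier_vec n" using Sc Seq by auto
    have "(UNIV :: 'a set) \<noteq> {0}" by (metis UNIV_I singletonD one_neq_zero)
    hence "b1 \<noteq> 0\<^sub>v n" using li zero_nin_lin_indpt[OF Sc li] Seq by auto
    then obtain p where p: "p < n" "b1 $ p \<noteq> 0" using b1c by (metis eq_vecI carrier_vecD index_zero_vec)
    \<comment> \<open>The vanishing minors in rows \<open>i\<close> and \<open>p\<close> say that
      these coefficients give a relation between \<open>b1\<close> and \<open>b2\<close>; it is
      nontrivial because \<open>b1 $ p\<close>, the coefficient of \<open>b2\<close> up to sign, is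
      nonzero.\<close>
    let ?a = "(\<lambda>_. 0)(b1 := b2 $ p, b2 := - b1 $ p)"
    have "lincomb ?a S = 0\<^sub>v n"
    proof (rule eq_vecI)
      fix i assume "i < dim_vec (0\<^sub>v n)"
      hence i: "i < n" by simp
      show "lincomb ?a S $ i = 0\<^sub>v n $ i"
        using lincomb_index[OF i Sc, of ?a] i ne min[OF i p(1)] by (simp add: Seq algebra_simps)
    qed (use lincomb_dim[OF finS Sc] in simp)
    hence "lin_dep S"
      using lin_dep_crit[OF finS subset_refl, where a = ?a and v = b2] p ne by (auto simp: Seq)
    thus False using li by simp
  qed
qed

text \<open>\<open>to_fract\<close> is an injective ring homomorphism, so minors vanish over the
  fraction field exactly if they vanish over the polynomial ring.\<close>

lemma mpol_rank_2_minors: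
  fixes M :: "('v::linorder, 'k::field) mpol mat"
  assumes M: "M \<in> carrier_mat m n" and rank: "mpol_rank M = 2"
  shows "vanish3 m n (\<lambda>i j. M $$ (i, j))" "\<not> vanish2 m n (\<lambda>i j. M $$ (i, j))"
proof -
  let ?F = "\<lambda>i j. map_mat to_fract M $$ (i, j)"
  have F: "map_mat to_fract M \<in> carrier_mat m n" using M by simp
  have rk: "vec_space.rank m (map_mat to_fract M) = 2"
    using rank M by (auto simp: mpol_rank_def)
  have eq: "?F i j = to_fract (M $$ (i, j))" if "i < m" "j < n" for i j
    using that M by simp
  have m3: "minor3 (\<lambda>i j. to_fract (M $$ (i, j))) i k p j l q =
    to_fract (minor3 (\<lambda>i j. M $$ (i, j)) i k p j l q)" for i k p j l q
    by (simp add: minor3_def)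
  have m2: "minor2 (\<lambda>i j. to_fract (M $$ (i, j))) i k j l =
    to_fract (minor2 (\<lambda>i j. M $$ (i, j)) i k j l)" for i k j l
    by (simp add: minor2_def)
  have "vanish3 m n (\<lambda>i j. to_fract (M $$ (i, j)))" "\<not> vanish2 m n (\<lambda>i j. to_fract (M $$ (i, j)))"
    using vec_space.rank_2_minors[OF F rk] vanish3_cong[of m n ?F, OF eq] vanish2_cong[of m n ?F, OF eq]
    by auto
  thus "vanish3 m n (\<lambda>i j. M $$ (i, j))" "\<not> vanish2 m n (\<lambda>i j. M $$ (i, j))"
    by (simp_all add: vanish3_def vanish2_def m3 m2)
qed

text \<open>Vanishing on the diagonal is a separate assumption, since in characteristic 2 it does
  not follow from \<open>f x x + f x x = 0\<close>. The induction splits off one index, whose row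
  and column cancel.\<close>

lemma sum_alternating_eq_0:
  fixes f :: "'a \<Rightarrow> 'a \<Rightarrow> 'b::ab_group_add"
  assumes "finite A" "\<And>x. x \<in> A \<Longrightarrow> f x x = 0" "\<And>x y. x \<in> A \<Longrightarrow> y \<in> A \<Longrightarrow> f x y + f y x = 0"
  shows "(\<Sum>x\<in>A. \<Sum>y\<in>A. f x y) = 0"
  using assms
proof (induction A rule: finite_induct)
  case (insert a A)
  have "(\<Sum>x\<in>insert a A. \<Sum>y\<in>insert a A. f x y) =
    f a a + (\<Sum>y\<in>A. f a y + f y a) + (\<Sum>x\<in>A. \<Sum>y\<in>A. f x y)"
    using insert.hyps by (simp add: sum.distrib algebra_simps)
  thus ?case using insert by simp
qed simp

text \<open>A quadratic form is zero once it vanishes at all \<open>e\<^sub>t\<close> and \<open>e\<^sub>t + e\<^sub>u\<close>, so no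
  assumption on the size of the field is needed.\<close>

lemma ex_ev_minor_neq_0:
  fixes p q r s :: "('v, 'k::field) mpol"
  assumes "p * q - r * s \<noteq> 0"
  shows "\<exists>a. ev a p * ev a q - ev a r * ev a s \<noteq> 0"
proof (rule ccontr)
  assume "\<not> ?thesis"
  hence z: "ev a p * ev a q - ev a r * ev a s = 0" for a by blast
  let ?A = "Poly_Mapping.keys p \<union> Poly_Mapping.keys q \<union> Poly_Mapping.keys r \<union> Poly_Mapping.keys s"
  let ?l = "Poly_Mapping.lookup"
  \<comment> \<open>The matrix of the quadratic form whose values are
    \<open>ev a p * ev a q - ev a r * ev a s\<close>. Unit vectors and sums of two unit vectors as
    test points show that it is alternating.\<close>
  define d where "d t u = ?l p t * ?l q u - ?l r t * ?l s u" for t u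
  have fin: "finite ?A" by simp
  have ev1: "ev (\<lambda>w. if w = t then 1 else 0) g = ?l g t" for t and g :: "('v, 'k) mpol"
    by (subst ev_superset[of "insert t (Poly_Mapping.keys g)"]) (auto simp: if_distrib[of "\<lambda>x. x * _"] cong: if_cong)
  have lin: "ev (\<lambda>w. a w + b w) g = ev a g + ev b g" for a b and g :: "('v, 'k) mpol"
    by (simp add: ev_def algebra_simps sum.distrib)
  have d1: "d t t = 0" for t
    using z[of "\<lambda>w. if w = t then 1 else 0"] by (simp add: ev1 d_def)
  have d2: "d t u + d u t = 0" for t u
    using z[of "\<lambda>w. (if w = t then 1 else 0) + (if w = u then 1 else 0)"] d1[of t] d1[of u]
    by (simp add: ev1 lin d_def algebra_simps)
  have ex: "g = (\<Sum>t\<in>?A. Poly_Mapping.single t (?l g t))" if "g \<in> {p, q, r, s}" for g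
    by (subst sum_monomials, rule sum.mono_neutral_left) (use that in \<open>auto simp: in_keys_iff\<close>)
  have pr: "g * h = (\<Sum>t\<in>?A. \<Sum>u\<in>?A. Poly_Mapping.single (t + u) (?l g t * ?l h u))"
    if "g \<in> {p, q, r, s}" "h \<in> {p, q, r, s}" for g h
    by (subst ex[OF that(1)], subst ex[OF that(2)]) (simp only: sum_product mult_single)
  have "p * q - r * s = (\<Sum>t\<in>?A. \<Sum>u\<in>?A. Poly_Mapping.single (t + u) (d t u))"
    by (subst (1 2) pr) (simp_all only: insert_iff simp_thms d_def single_diff sum_subtractf)
  \<comment> \<open>The monomial \<open>t + u\<close> is symmetric in \<open>t\<close> and
    \<open>u\<close>, so an alternating family of coefficients sums to zero.\<close>
  also have "\<dots> = 0"
    by (rule sum_alternating_eq_0[OF fin]) (simp_all add: d1 d2 add.commute flip: single_add)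
  finally show False using assms by simp
qed

section \<open>Elementary operations over the base field\<close>

text \<open>\<open>invertible_mat\<close> leaves the size of the inverse open; it is recovered by
  comparing dimensions in the two products.\<close>

lemma invertible_mat_iff:
  assumes "S \<in> carrier_mat m m"
  shows "invertible_mat S \<longleftrightarrow> (\<exists>S' \<in> carrier_mat m m. S * S' = 1\<^sub>m m \<and> S' * S = 1\<^sub>m m)"
proof
  assume "invertible_mat S"
  then obtain B where B: "S * B = 1\<^sub>m m" "B * S = 1\<^sub>m (dim_row B)"
    using assms by (auto simp: invertible_mat_def inverts_mat_def)
  have "dim_col B = m" using B(1) by (metis index_mult_mat(3) index_one_mat(3))
  moreover have "dim_row B = m" using B(2) assms by (metis index_mult_mat(3) index_one_mat(3) carrier_matD(2))
  ultimately show "\<exists>S' \<in> carrier_mat m m. S * S' = 1\<^sub>m m \<and> S' * S = 1\<^sub>m m"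
    using B by (intro bexI[of _ B]) auto
qed (use assms in \<open>auto simp: invertible_mat_def inverts_mat_def\<close>)

lemma invertible_mat_mult:
  assumes S: "S \<in> carrier_mat m m" "invertible_mat S" and P: "P \<in> carrier_mat m m" "invertible_mat P"
  shows "invertible_mat (P * S :: 'a::comm_ring_1 mat)"
proof -
  obtain S' where S': "S' \<in> carrier_mat m m" "S * S' = 1\<^sub>m m" "S' * S = 1\<^sub>m m"
    using S invertible_mat_iff by blast
  obtain P' where P': "P' \<in> carrier_mat m m" "P * P' = 1\<^sub>m m" "P' * P = 1\<^sub>m m"
    using P invertible_mat_iff by blast
  have "P * S * (S' * P') = P * (S * S') * P'"
    using S(1) P(1) S'(1) P'(1) by (simp add: assoc_mult_mat[where ?n\<^sub>2.0 = m and ?n\<^sub>3.0 = m and ?n\<^sub>4.0 = m])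
  also have "\<dots> = 1\<^sub>m m" using P(1) P' S' by simp
  finally have 1: "P * S * (S' * P') = 1\<^sub>m m" .
  have "S' * P' * (P * S) = S' * (P' * P) * S"
    using S(1) P(1) S'(1) P'(1) by (simp add: assoc_mult_mat[where ?n\<^sub>2.0 = m and ?n\<^sub>3.0 = m and ?n\<^sub>4.0 = m])
  also have "\<dots> = 1\<^sub>m m" using S(1) P' S' by simp
  finally have 2: "S' * P' * (P * S) = 1\<^sub>m m" .
  show ?thesis
    unfolding invertible_mat_iff[OF mult_carrier_mat[OF P(1) S(1)]]
    using 1 2 mult_carrier_mat[OF S'(1) P'(1)] by blast
qed

lemma invertible_mat_transpose:
  assumes "S \<in> carrier_mat m m" "invertible_mat (S :: 'a::comm_ring_1 mat)"
  shows "invertible_mat (transpose_mat S)"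
proof -
  obtain S' where S': "S' \<in> carrier_mat m m" "S * S' = 1\<^sub>m m" "S' * S = 1\<^sub>m m"
    using assms invertible_mat_iff by blast
  have "transpose_mat S * transpose_mat S' = 1\<^sub>m m" "transpose_mat S' * transpose_mat S = 1\<^sub>m m"
    using S' assms(1) by (metis transpose_mult transpose_one)+
  thus ?thesis
    using S'(1) assms(1) by (subst invertible_mat_iff[of _ m]) auto
qed

section \<open>Equivalence over the base field\<close>

lemma semiring_hom_const_mpol: "semiring_hom (const_mpol :: 'k::field \<Rightarrow> ('v, 'k) mpol)"
  by unfold_locales (simp_all add: const_mpol_add const_mpol_mult)

lemmas map_const_mpol_mult = semiring_hom.mat_hom_mult[OF semiring_hom_const_mpol]

lemma equivalent_over_K_refl:
  fixes M :: "('v, 'k::field) mpol mat"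
  shows "equivalent_over_K M M"
proof -
  have one: "map_mat const_mpol (1\<^sub>m k :: 'k mat) = (1\<^sub>m k :: ('v, 'k) mpol mat)" for k
    by (rule eq_matI) auto
  have inv: "invertible_mat (1\<^sub>m k :: 'k mat)" for k
    by (subst invertible_mat_iff[of _ k]) (auto intro!: bexI[of _ "1\<^sub>m k"])
  have M: "M \<in> carrier_mat (dim_row M) (dim_col M)" by simp
  show ?thesis
    unfolding equivalent_over_K_def
    using one inv left_mult_one_mat[OF M] right_mult_one_mat[OF M]
    by (intro bexI[of _ "1\<^sub>m (dim_row M)"] bexI[of _ "1\<^sub>m (dim_col M)"] conjI) simp_all
qed

lemma equivalent_over_K_left_mult:
  fixes M :: "('v, 'k::field) mpol mat"
  assumes M: "M \<in> carrier_mat m n" and eq: "equivalent_over_K M N"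
    and P: "P \<in> carrier_mat m m" "invertible_mat P"
  shows "equivalent_over_K M (map_mat const_mpol P * N)"
proof -
  obtain S T where S: "S \<in> carrier_mat m m" "invertible_mat S"
    and T: "T \<in> carrier_mat n n" "invertible_mat T"
    and N: "N = map_mat const_mpol S * M * map_mat const_mpol T"
    using eq M unfolding equivalent_over_K_def by (metis carrier_matD)
  have "map_mat const_mpol P * N = map_mat const_mpol (P * S) * M * map_mat const_mpol T"
    unfolding N map_const_mpol_mult[OF P(1) S(1)] using P(1) S(1) M T(1)
    by (simp add: assoc_mult_mat[of _ m m _ m _ n] assoc_mult_mat[of _ m m _ n _ n] assoc_mult_mat[of _ m n _ n _ n])
  thus ?thesis
    using S T P M invertible_mat_mult[OF S P] unfolding equivalent_over_K_def
    by (intro bexI[of _ "P * S"] bexI[of _ T] conjI) auto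
qed

text \<open>Transposition exchanges the roles of \<open>S\<close> and \<open>T\<close>, so
  statements about columns can be deduced from statements about rows.\<close>

lemma equivalent_over_K_transpose:
  fixes M :: "('v, 'k::field) mpol mat"
  assumes M: "M \<in> carrier_mat m n" and eq: "equivalent_over_K M N"
  shows "equivalent_over_K (transpose_mat M) (transpose_mat N)"
proof -
  obtain S T where S: "S \<in> carrier_mat m m" "invertible_mat S"
    and T: "T \<in> carrier_mat n n" "invertible_mat T"
    and N: "N = map_mat const_mpol S * M * map_mat const_mpol T"
    using eq M unfolding equivalent_over_K_def by (metis carrier_matD)
  have tr: "transpose_mat (map_mat const_mpol A) = map_mat const_mpol (transpose_mat A)" for A :: "'k mat"
    by (rule eq_matI) auto
  have "transpose_mat N = map_mat const_mpol (transpose_mat T) *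
      (transpose_mat M * map_mat const_mpol (transpose_mat S))"
    unfolding N using S T M by (simp add: transpose_mult[of _ m m _ n] transpose_mult[of _ m n _ n] tr)
  also have "\<dots> = map_mat const_mpol (transpose_mat T) * transpose_mat M * map_mat const_mpol (transpose_mat S)"
    using S T M by (simp add: assoc_mult_mat[of _ n n _ m _ m])
  finally show ?thesis
    unfolding equivalent_over_K_def
    using S T M invertible_mat_transpose[OF S] invertible_mat_transpose[OF T]
    by (intro bexI[of _ "transpose_mat T"] bexI[of _ "transpose_mat S"] conjI) auto
qed

lemma equivalent_over_K_dim:
  assumes "M \<in> carrier_mat m n" "equivalent_over_K M N"
  shows "N \<in> carrier_mat m n"
  using assms unfolding equivalent_over_K_def by (elim bexE conjE, intro carrier_matI) simp_all

text \<open>As a left factor this scales each row \<open>i\<close> by \<open>c i\<close> and adds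
  \<open>d i\<close> times row \<open>k\<close>. Treating all rows at once lets one matrix do a
  complete clearing step with pivot row \<open>k\<close>.\<close>

definition lincomb_mat :: "nat \<Rightarrow> nat \<Rightarrow> (nat \<Rightarrow> 'a) \<Rightarrow> (nat \<Rightarrow> 'a) \<Rightarrow> 'a::comm_ring_1 mat" where
  "lincomb_mat m k c d = mat m m (\<lambda>(i, l). (if l = i then c i else 0) + (if l = k then d i else 0))"

lemma lincomb_mat_carrier [simp]: "lincomb_mat m k c d \<in> carrier_mat m m"
  by (simp add: lincomb_mat_def)

lemma lincomb_mat_mult:
  assumes "X \<in> carrier_mat m n" "i < m" "j < n" "k < m"
  shows "(lincomb_mat m k c d * X) $$ (i, j) = c i * X $$ (i, j) + d i * X $$ (k, j)"
proof -
  have "(lincomb_mat m k c d * X) $$ (i, j) =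
    (\<Sum>l\<in>{0..<m}. ((if l = i then c i else 0) + (if l = k then d i else 0)) * X $$ (l, j))"
    using assms by (simp add: lincomb_mat_def scalar_prod_def)
  also have "\<dots> = (\<Sum>l\<in>{0..<m}. (if l = i then c i * X $$ (i, j) else 0) + (if l = k then d i * X $$ (k, j) else 0))"
    by (rule sum.cong) (auto simp: algebra_simps)
  finally show ?thesis using assms by (simp add: sum.distrib algebra_simps)
qed

text \<open>As \<open>d k = 0\<close>, the operation merely scales row \<open>k\<close> by
  \<open>c k\<close>. The old row \<open>k\<close> can therefore be recovered, and subtracting its
  multiples from the other rows yields the coefficients of the inverse.\<close>

lemma lincomb_mat_inverse:
  fixes c d :: "nat \<Rightarrow> 'k::field"
  assumes "\<And>i. i < m \<Longrightarrow> c i \<noteq> 0" "d k = 0" "k < m"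
  shows "lincomb_mat m k c d * lincomb_mat m k (\<lambda>i. 1 / c i) (\<lambda>i. - d i / (c i * c k)) = 1\<^sub>m m"
    (is "_ * ?B = _")
proof (rule eq_matI)
  fix i j assume "i < dim_row (1\<^sub>m m :: 'k mat)" "j < dim_col (1\<^sub>m m :: 'k mat)"
  hence ij: "i < m" "j < m" by auto
  show "(lincomb_mat m k c d * ?B) $$ (i, j) = 1\<^sub>m m $$ (i, j)"
    using ij assms by (subst lincomb_mat_mult[of _ m m]) (auto simp: lincomb_mat_def field_simps)
qed (simp_all add: lincomb_mat_def)

lemma invertible_lincomb_mat:
  fixes c d :: "nat \<Rightarrow> 'k::field"
  assumes "\<And>i. i < m \<Longrightarrow> c i \<noteq> 0" "d k = 0" "k < m"
  shows "invertible_mat (lincomb_mat m k c d)"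
proof -
  let ?B = "lincomb_mat m k (\<lambda>i. 1 / c i) (\<lambda>i. - d i / (c i * c k))"
  \<comment> \<open>Taking inverse coefficients twice returns \<open>c\<close> and \<open>d\<close>,
    so the right inverse is also a left inverse.\<close>
  have "lincomb_mat m k (\<lambda>i. 1 / (1 / c i)) (\<lambda>i. - (- d i / (c i * c k)) / (1 / c i * (1 / c k)))
      = lincomb_mat m k c d"
    using assms by (intro eq_matI) (auto simp: lincomb_mat_def)
  hence "?B * lincomb_mat m k c d = 1\<^sub>m m"
    using lincomb_mat_inverse[of m "\<lambda>i. 1 / c i" "\<lambda>i. - d i / (c i * c k)" k] assms by simp
  thus ?thesis
    using lincomb_mat_inverse[of m c d k] assms by (subst invertible_mat_iff[of _ m]) auto
qed

definition perm_mat :: "nat \<Rightarrow> (nat \<Rightarrow> nat) \<Rightarrow> 'a::comm_ring_1 mat" where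
  "perm_mat m \<sigma> = mat m m (\<lambda>(i, l). if l = \<sigma> i then 1 else 0)"

lemma perm_mat_carrier [simp]: "perm_mat m \<sigma> \<in> carrier_mat m m"
  by (simp add: perm_mat_def)

lemma perm_mat_mult:
  assumes "X \<in> carrier_mat m n" "i < m" "j < n" "\<sigma> i < m"
  shows "(perm_mat m \<sigma> * X) $$ (i, j) = X $$ (\<sigma> i, j)"
proof -
  have "(perm_mat m \<sigma> * X) $$ (i, j) = (\<Sum>l\<in>{0..<m}. (if l = \<sigma> i then 1 else 0) * X $$ (l, j))"
    using assms by (simp add: perm_mat_def scalar_prod_def)
  also have "\<dots> = (\<Sum>l\<in>{0..<m}. if l = \<sigma> i then X $$ (\<sigma> i, j) else 0)"
    by (rule sum.cong) auto
  finally show ?thesis using assms by simp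
qed

text \<open>An involution makes the matrix its own inverse; the swaps used for pivoting are of this
  kind.\<close>

lemma invertible_perm_mat:
  assumes "\<And>i. i < m \<Longrightarrow> \<sigma> i < m" "\<And>i. i < m \<Longrightarrow> \<sigma> (\<sigma> i) = i"
  shows "invertible_mat (perm_mat m \<sigma> :: 'a::comm_ring_1 mat)"
proof -
  have "perm_mat m \<sigma> * perm_mat m \<sigma> = (1\<^sub>m m :: 'a mat)"
  proof (rule eq_matI)
    fix i j assume "i < dim_row (1\<^sub>m m :: 'a mat)" "j < dim_col (1\<^sub>m m :: 'a mat)"
    thus "(perm_mat m \<sigma> * perm_mat m \<sigma>) $$ (i, j) = (1\<^sub>m m :: 'a mat) $$ (i, j)"
      using assms by (subst perm_mat_mult[of _ m m]) (auto simp: perm_mat_def)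
  qed (simp_all add: perm_mat_def)
  thus ?thesis by (subst invertible_mat_iff[of _ m]) auto
qed

text \<open>The invariant of the reduction. The last condition says that the values of
  \<open>N\<close> at \<open>a\<close> form a matrix of rank at least two. Keeping \<open>a\<close>
  fixed lets pivots be chosen in this constant matrix while the operations act on
  \<open>N\<close>.\<close>

definition reach :: "('v, 'k::field) mpol mat \<Rightarrow> (('v \<Rightarrow>\<^sub>0 nat) \<Rightarrow> 'k) \<Rightarrow> ('v, 'k) mpol mat \<Rightarrow> bool" where
  "reach M a N \<longleftrightarrow> equivalent_over_K M N \<and>
     (\<forall>i<dim_row M. \<forall>j<dim_col M. aff (N $$ (i, j))) \<and>
     vanish3 (dim_row M) (dim_col M) (\<lambda>i j. N $$ (i, j)) \<and>
     \<not> vanish2 (dim_row M) (dim_col M) (\<lambda>i j. N $$ (i, j)) \<and>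
     \<not> vanish2 (dim_row M) (dim_col M) (\<lambda>i j. ev a (N $$ (i, j)))"

section \<open>Stability of the invariant under transposition, row and column operations\<close>

lemma reach_carrier: "M \<in> carrier_mat m n \<Longrightarrow> reach M a N \<Longrightarrow> N \<in> carrier_mat m n"
  using equivalent_over_K_dim by (auto simp: reach_def)

lemma reach_transpose:
  assumes M: "M \<in> carrier_mat m n" and N: "reach M a N"
  shows "reach (transpose_mat M) a (transpose_mat N)"
proof -
  have Nc: "N \<in> carrier_mat m n" using reach_carrier assms by blast
  have "vanish3 n m (\<lambda>i j. transpose_mat N $$ (i, j)) = vanish3 n m (\<lambda>i j. N $$ (j, i))"
    "vanish2 n m (\<lambda>i j. transpose_mat N $$ (i, j)) = vanish2 n m (\<lambda>i j. N $$ (j, i))"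
    "vanish2 n m (\<lambda>i j. ev a (transpose_mat N $$ (i, j))) = vanish2 n m (\<lambda>i j. ev a (N $$ (j, i)))"
    by (rule vanish3_cong vanish2_cong; use Nc in simp)+
  thus ?thesis
    using N Nc M equivalent_over_K_transpose[OF M]
      vanish3_transpose[of n m "\<lambda>i j. N $$ (i, j)"] vanish2_transpose[of n m "\<lambda>i j. N $$ (i, j)"]
      vanish2_transpose[of n m "\<lambda>i j. ev a (N $$ (i, j))"]
    by (auto simp: reach_def)
qed

lemma reach_row_lincomb:
  assumes M: "M \<in> carrier_mat m n" and N: "reach M a N"
    and c: "\<And>i. i < m \<Longrightarrow> c i \<noteq> 0" and d: "d k = 0" and k: "k < m"
  obtains N' where "reach M a N'"
    "\<And>i j. i < m \<Longrightarrow> j < n \<Longrightarrow> N' $$ (i, j) = const_mpol (c i) * N $$ (i, j) + const_mpol (d i) * N $$ (k, j)"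
proof
  have Nc: "N \<in> carrier_mat m n" using reach_carrier assms by blast
  let ?P = "lincomb_mat m k c d"
  let ?N = "map_mat const_mpol ?P * N"
  have map: "map_mat const_mpol ?P = lincomb_mat m k (\<lambda>i. const_mpol (c i)) (\<lambda>i. const_mpol (d i))"
    by (rule eq_matI) (auto simp: lincomb_mat_def const_mpol_add)
  show ent: "?N $$ (i, j) = const_mpol (c i) * N $$ (i, j) + const_mpol (d i) * N $$ (k, j)"
    if "i < m" "j < n" for i j
    unfolding map using that lincomb_mat_mult[OF Nc _ _ k] by blast
  \<comment> \<open>Coefficients of the inverse operation. Linear combinations of rows preserve
    vanishing of minors; nonvanishing is therefore obtained by going back from \<open>?N\<close> to
    \<open>N\<close>.\<close>
  define c' where "c' i = 1 / c i" for i
  define d' where "d' i = - d i / (c i * c k)" for i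
  have inv: "N $$ (i, j) = const_mpol (c' i) * ?N $$ (i, j) + const_mpol (d' i) * ?N $$ (k, j)"
    if ij: "i < m" "j < n" for i j
  proof -
    have "const_mpol (c' i) * ?N $$ (i, j) + const_mpol (d' i) * ?N $$ (k, j) =
      const_mpol (c' i * c i) * N $$ (i, j) + const_mpol (c' i * d i + d' i * c k) * N $$ (k, j)"
      using ent[OF ij] ent[OF k ij(2)] d by (simp add: const_mpol_add const_mpol_mult algebra_simps)
    also have "\<dots> = N $$ (i, j)"
      using c[OF ij(1)] c[OF k] by (simp add: c'_def d'_def)
    finally show ?thesis ..
  qed
  have ev: "ev a (?N $$ (i, j)) = c i * ev a (N $$ (i, j)) + d i * ev a (N $$ (k, j))"
    if "i < m" "j < n" for i j
    using ent[OF that] by (simp add: ev_add ev_const_mult)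
  have ev': "ev a (N $$ (i, j)) = c' i * ev a (?N $$ (i, j)) + d' i * ev a (?N $$ (k, j))"
    if "i < m" "j < n" for i j
    using inv[OF that] by (metis ev_add ev_const_mult)
  have "equivalent_over_K M ?N"
    using N M invertible_lincomb_mat[where c = c and d = d, OF c d k] by (intro equivalent_over_K_left_mult[OF M]) (auto simp: reach_def)
  moreover have "aff (?N $$ (i, j))" if "i < m" "j < n" for i j
    using N M that k ent[OF that] by (auto simp: reach_def intro!: aff_add aff_const_mult)
  moreover have "vanish3 m n (\<lambda>i j. ?N $$ (i, j))"
  proof -
    have "vanish3 m n (\<lambda>i j. N $$ (i, j))" using N M by (simp add: reach_def)
    hence "vanish3 m n (\<lambda>i j. const_mpol (c i) * N $$ (i, j) + const_mpol (d i) * N $$ (k, j))"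
      using k by (rule vanish3_lincomb)
    thus ?thesis using vanish3_cong[of m n "\<lambda>i j. ?N $$ (i, j)", OF ent] by blast
  qed
  moreover have "\<not> vanish2 m n (\<lambda>i j. ?N $$ (i, j))"
  proof
    assume "vanish2 m n (\<lambda>i j. ?N $$ (i, j))"
    hence "vanish2 m n (\<lambda>i j. const_mpol (c' i) * ?N $$ (i, j) + const_mpol (d' i) * ?N $$ (k, j))"
      using k by (rule vanish2_lincomb)
    hence "vanish2 m n (\<lambda>i j. N $$ (i, j))"
      using vanish2_cong[of m n "\<lambda>i j. N $$ (i, j)", OF inv] by blast
    thus False using N M by (auto simp: reach_def)
  qed
  moreover have "\<not> vanish2 m n (\<lambda>i j. ev a (?N $$ (i, j)))"
  proof
    assume "vanish2 m n (\<lambda>i j. ev a (?N $$ (i, j)))"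
    hence "vanish2 m n (\<lambda>i j. c' i * ev a (?N $$ (i, j)) + d' i * ev a (?N $$ (k, j)))"
      using k by (rule vanish2_lincomb)
    hence "vanish2 m n (\<lambda>i j. ev a (N $$ (i, j)))"
      using vanish2_cong[of m n "\<lambda>i j. ev a (N $$ (i, j))", OF ev'] by blast
    thus False using N M by (auto simp: reach_def)
  qed
  ultimately show "reach M a ?N" using M by (simp add: reach_def)
qed

lemma reach_row_perm:
  assumes M: "M \<in> carrier_mat m n" and N: "reach M a N"
    and \<sigma>: "\<And>i. i < m \<Longrightarrow> \<sigma> i < m" "\<And>i. i < m \<Longrightarrow> \<sigma> (\<sigma> i) = i"
  obtains N' where "reach M a N'"
    "\<And>i j. i < m \<Longrightarrow> j < n \<Longrightarrow> N' $$ (i, j) = N $$ (\<sigma> i, j)"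
proof
  have Nc: "N \<in> carrier_mat m n" using reach_carrier assms by blast
  let ?N = "map_mat const_mpol (perm_mat m \<sigma>) * N"
  have map: "map_mat const_mpol (perm_mat m \<sigma>) = perm_mat m \<sigma>"
    by (rule eq_matI) (auto simp: perm_mat_def)
  show ent: "?N $$ (i, j) = N $$ (\<sigma> i, j)" if "i < m" "j < n" for i j
    unfolding map using that perm_mat_mult[OF Nc] \<sigma> by blast
  have inv: "N $$ (i, j) = ?N $$ (\<sigma> i, j)" if "i < m" "j < n" for i j
    using that \<sigma> by (simp add: ent)
  have "equivalent_over_K M ?N"
    using N M invertible_perm_mat[OF \<sigma>] by (intro equivalent_over_K_left_mult[OF M]) (auto simp: reach_def)
  moreover have "aff (?N $$ (i, j))" if "i < m" "j < n" for i j
    using N M that \<sigma> ent[OF that] by (auto simp: reach_def)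
  moreover have "vanish3 m n (\<lambda>i j. ?N $$ (i, j))"
  proof -
    have "vanish3 m n (\<lambda>i j. N $$ (i, j))" using N M by (simp add: reach_def)
    hence "vanish3 m n (\<lambda>i j. N $$ (\<sigma> i, j))" using \<sigma>(1) by (rule vanish3_perm)
    thus ?thesis using vanish3_cong[of m n "\<lambda>i j. ?N $$ (i, j)", OF ent] by blast
  qed
  moreover have "\<not> vanish2 m n (\<lambda>i j. ?N $$ (i, j))"
  proof
    assume "vanish2 m n (\<lambda>i j. ?N $$ (i, j))"
    hence "vanish2 m n (\<lambda>i j. ?N $$ (\<sigma> i, j))" using \<sigma>(1) by (rule vanish2_perm)
    hence "vanish2 m n (\<lambda>i j. N $$ (i, j))"
      using vanish2_cong[of m n "\<lambda>i j. N $$ (i, j)", OF inv] by blast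
    thus False using N M by (auto simp: reach_def)
  qed
  moreover have "\<not> vanish2 m n (\<lambda>i j. ev a (?N $$ (i, j)))"
  proof
    assume "vanish2 m n (\<lambda>i j. ev a (?N $$ (i, j)))"
    hence "vanish2 m n (\<lambda>i j. ev a (?N $$ (\<sigma> i, j)))" using \<sigma>(1) by (rule vanish2_perm)
    hence "vanish2 m n (\<lambda>i j. ev a (N $$ (i, j)))"
      using vanish2_cong[of m n "\<lambda>i j. ev a (N $$ (i, j))", OF arg_cong[where f = "ev a", OF inv]] by blast
    thus False using N M by (auto simp: reach_def)
  qed
  ultimately show "reach M a ?N" using M by (simp add: reach_def)
qed

lemma reach_col_lincomb:
  assumes M: "M \<in> carrier_mat m n" and N: "reach M a N"
    and c: "\<And>j. j < n \<Longrightarrow> c j \<noteq> 0" and d: "d k = 0" and k: "k < n"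
  obtains N' where "reach M a N'"
    "\<And>i j. i < m \<Longrightarrow> j < n \<Longrightarrow> N' $$ (i, j) = const_mpol (c j) * N $$ (i, j) + const_mpol (d j) * N $$ (i, k)"
proof -
  have Nc: "N \<in> carrier_mat m n" using reach_carrier assms by blast
  have Mt: "transpose_mat M \<in> carrier_mat n m" using M by simp
  obtain N' where N': "reach (transpose_mat M) a N'"
    and e: "\<And>i j. i < n \<Longrightarrow> j < m \<Longrightarrow>
      N' $$ (i, j) = const_mpol (c i) * transpose_mat N $$ (i, j) + const_mpol (d i) * transpose_mat N $$ (k, j)"
    using reach_row_lincomb[OF Mt reach_transpose[OF M N], of c d k] c d k by metis
  have "reach M a (transpose_mat N')" using reach_transpose[OF Mt N'] by simp
  moreover have "N' \<in> carrier_mat n m" using reach_carrier[OF Mt N'] .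
  ultimately show thesis using e Nc k by (intro that[of "transpose_mat N'"]) auto
qed

lemma reach_col_perm:
  assumes M: "M \<in> carrier_mat m n" and N: "reach M a N"
    and \<sigma>: "\<And>j. j < n \<Longrightarrow> \<sigma> j < n" "\<And>j. j < n \<Longrightarrow> \<sigma> (\<sigma> j) = j"
  obtains N' where "reach M a N'"
    "\<And>i j. i < m \<Longrightarrow> j < n \<Longrightarrow> N' $$ (i, j) = N $$ (i, \<sigma> j)"
proof -
  have Nc: "N \<in> carrier_mat m n" using reach_carrier assms by blast
  have Mt: "transpose_mat M \<in> carrier_mat n m" using M by simp
  obtain N' where N': "reach (transpose_mat M) a N'"
    and e: "\<And>i j. i < n \<Longrightarrow> j < m \<Longrightarrow> N' $$ (i, j) = transpose_mat N $$ (\<sigma> i, j)"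
    using reach_row_perm[OF Mt reach_transpose[OF M N], of \<sigma>] \<sigma> by metis
  have "reach M a (transpose_mat N')" using reach_transpose[OF Mt N'] by simp
  moreover have "N' \<in> carrier_mat n m" using reach_carrier[OF Mt N'] .
  ultimately show thesis using e Nc \<sigma> by (intro that[of "transpose_mat N'"]) auto
qed

section \<open>Syzygies of linear forms\<close>

text \<open>The determinant is homogeneous of degree 3 in its entries, and each lifted entry is
  \<open>s\<close> times its image under the homomorphism \<open>\<Psi>\<close>. Hence the lifted
  determinant is \<open>s ^ 3\<close> times the image of zero. The next two lemmas follow the same
  pattern.\<close>

lemma polarize_minor3:
  fixes f :: "nat \<Rightarrow> nat \<Rightarrow> ('v::linorder, 'k::field) mpol"
  assumes fin: "finite (UNIV :: 'v set)"
    and aff: "\<And>r c. r \<in> {i, k, p} \<Longrightarrow> c \<in> {j, l, q} \<Longrightarrow> aff (f r c)"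
    and zero: "minor3 f i k p j l q = 0"
  shows "minor3 (\<lambda>r c. lift a (f r c)) i k p j l q = 0"
proof -
  obtain \<Psi> :: "('v, 'k) mpol \<Rightarrow> ('v, 'k) mpol poly fract" and s where
    P: "\<Psi> 0 = 0" "\<And>p q. \<Psi> (p + q) = \<Psi> p + \<Psi> q" "\<And>p q. \<Psi> (p - q) = \<Psi> p - \<Psi> q"
    "\<And>p q. \<Psi> (p * q) = \<Psi> p * \<Psi> q" "\<And>p. aff p \<Longrightarrow> to_fract (lift a p) = s * \<Psi> p"
    by (rule shift_hom[OF fin, where a = a]) (rule that)
  have "to_fract (minor3 (\<lambda>r c. lift a (f r c)) i k p j l q) = s ^ 3 * \<Psi> (minor3 f i k p j l q)"
    by (simp add: minor3_def P aff) (simp add: algebra_simps power3_eq_cube)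
  thus ?thesis using zero P(1) by simp
qed

lemma polarize_quadratic:
  fixes p q r t :: "('v::linorder, 'k::field) mpol"
  assumes fin: "finite (UNIV :: 'v set)" and aff: "aff p" "aff q" "aff r" "aff t"
    and zero: "p * q + r * t = 0"
  shows "lift a p * lift a q + lift a r * lift a t = 0"
proof -
  obtain \<Psi> :: "('v, 'k) mpol \<Rightarrow> ('v, 'k) mpol poly fract" and s where
    P: "\<Psi> 0 = 0" "\<And>p q. \<Psi> (p + q) = \<Psi> p + \<Psi> q" "\<And>p q. \<Psi> (p - q) = \<Psi> p - \<Psi> q"
    "\<And>p q. \<Psi> (p * q) = \<Psi> p * \<Psi> q" "\<And>p. aff p \<Longrightarrow> to_fract (lift a p) = s * \<Psi> p"
    by (rule shift_hom[OF fin, where a = a]) (rule that)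
  have "to_fract (lift a p * lift a q + lift a r * lift a t) = s ^ 2 * \<Psi> (p * q + r * t)"
    by (simp add: P aff) (simp add: algebra_simps power2_eq_square)
  hence "to_fract (lift a p * lift a q + lift a r * lift a t) = 0"
    unfolding zero P(1) by simp
  thus ?thesis unfolding to_fract_eq_0_iff .
qed

lemma polarize_cubic:
  fixes u v p q r :: "('v::linorder, 'k::field) mpol"
  assumes fin: "finite (UNIV :: 'v set)" and aff: "aff u" "aff v" "aff p" "aff q" "aff r"
    and zero: "u * u * p + u * v * q - v * v * r = 0"
  shows "lift a u * lift a u * lift a p + lift a u * lift a v * lift a q - lift a v * lift a v * lift a r = 0"
proof -
  obtain \<Psi> :: "('v, 'k) mpol \<Rightarrow> ('v, 'k) mpol poly fract" and s where
    P: "\<Psi> 0 = 0" "\<And>p q. \<Psi> (p + q) = \<Psi> p + \<Psi> q" "\<And>p q. \<Psi> (p - q) = \<Psi> p - \<Psi> q"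
    "\<And>p q. \<Psi> (p * q) = \<Psi> p * \<Psi> q" "\<And>p. aff p \<Longrightarrow> to_fract (lift a p) = s * \<Psi> p"
    by (rule shift_hom[OF fin, where a = a]) (rule that)
  have "to_fract (lift a u * lift a u * lift a p + lift a u * lift a v * lift a q - lift a v * lift a v * lift a r)
      = s ^ 3 * \<Psi> (u * u * p + u * v * q - v * v * r)"
    by (simp add: P aff) (simp add: algebra_simps power3_eq_cube)
  hence "to_fract (lift a u * lift a u * lift a p + lift a u * lift a v * lift a q
      - lift a v * lift a v * lift a r) = 0"
    unfolding zero P(1) by simp
  thus ?thesis unfolding to_fract_eq_0_iff .
qed

definition lin_indep2 :: "('v, 'k::field) mpol \<Rightarrow> ('v, 'k) mpol \<Rightarrow> bool" where
  "lin_indep2 p q \<longleftrightarrow> (\<forall>a b. const_mpol a * p + const_mpol b * q = 0 \<longrightarrow> a = 0 \<and> b = 0)"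

lemma lin_indep2_commute: "lin_indep2 p q \<Longrightarrow> lin_indep2 q p"
  unfolding lin_indep2_def by (metis add.commute)

lemma lin_indep2_nonzero: "lin_indep2 p q \<Longrightarrow> p \<noteq> 0"
  unfolding lin_indep2_def by (metis add_0 const_mpol_0 mult_zero_left mult_zero_right one_neq_zero)

lemma ex_dual_point:
  fixes p q :: "('v, 'k::field) mpol"
  assumes "lin_indep2 p q"
  shows "\<exists>a. ev a p = 0 \<and> ev a q = 1"
proof -
  let ?l = "Poly_Mapping.lookup"
  have "p \<noteq> 0" using assms by (rule lin_indep2_nonzero)
  then obtain t where t: "?l p t \<noteq> 0" by (metis lookup_zero poly_mapping_eqI)
  \<comment> \<open>One elimination step: \<open>g\<close> is \<open>q\<close> with its coefficient
    at \<open>t\<close> cleared by means of \<open>p\<close>.\<close>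
  define g where "g = q - const_mpol (?l q t / ?l p t) * p"
  have "g \<noteq> 0"
  proof
    assume "g = 0"
    hence "const_mpol (- (?l q t / ?l p t)) * p + const_mpol 1 * q = 0"
      by (simp add: g_def const_mpol_uminus)
    thus False using assms unfolding lin_indep2_def by (metis one_neq_zero)
  qed
  then obtain u where u: "?l g u \<noteq> 0" by (metis lookup_zero poly_mapping_eqI)
  \<comment> \<open>A combination of the unit vectors at \<open>u\<close> and \<open>t\<close>. The
    coefficient at \<open>t\<close> is chosen such that \<open>p\<close> is annihilated; on
    \<open>q\<close> the undivided combination takes the value \<open>?l g u\<close>, hence the
    division.\<close>
  define a where "a w = (if w = u then 1 / ?l g u else 0) +
    (if w = t then - (?l p u / ?l p t) / ?l g u else 0)" for w
  have ev: "ev a r = ?l r u / ?l g u - (?l p u / ?l p t) / ?l g u * ?l r t" for r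
  proof -
    have "ev a r = (\<Sum>w\<in>insert u (insert t (Poly_Mapping.keys r)). a w * ?l r w)"
      by (rule ev_superset) auto
    also have "\<dots> = (\<Sum>w\<in>insert u (insert t (Poly_Mapping.keys r)).
        (if w = u then ?l r u / ?l g u else 0) + (if w = t then - (?l p u / ?l p t) / ?l g u * ?l r t else 0))"
      by (rule sum.cong) (auto simp: a_def algebra_simps)
    also have "\<dots> = ?l r u / ?l g u - (?l p u / ?l p t) / ?l g u * ?l r t"
      unfolding sum.distrib by simp
    finally show ?thesis .
  qed
  have gu: "?l g u = ?l q u - ?l q t / ?l p t * ?l p u"
    by (simp add: g_def lookup_minus)
  have "ev a p = 0" using t u by (simp add: ev)
  moreover have "ev a q = (?l q u - ?l q t / ?l p t * ?l p u) / ?l g u"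
    using t u by (simp add: ev field_simps)
  hence "ev a q = 1" unfolding gu[symmetric] using u by simp
  ultimately show ?thesis by blast
qed

text \<open>Comparing coefficients along directions dual to \<open>p\<close> and \<open>q\<close> replaces an appeal to
  unique factorization in the next two lemmas.\<close>

lemma linear_syzygy:
  fixes p q b1 b2 :: "('v::linorder, 'k::field) mpol"
  assumes fin: "finite (UNIV :: 'v set)" and aff: "aff p" "aff q" "aff b1" "aff b2"
    and indep: "lin_indep2 p q" and zero: "p * b1 + q * b2 = 0"
  shows "\<exists>\<mu>. b1 = - const_mpol \<mu> * q \<and> b2 = const_mpol \<mu> * p"
proof -
  obtain a where a: "ev a p = 0" "ev a q = 1" using ex_dual_point[OF indep] by blast
  \<comment> \<open>The lifts of \<open>p\<close> and \<open>q\<close> are p and q + t. The two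
    equations come from the coefficients of t and t^2 in the lifted syzygy.\<close>
  have "q * const_mpol (ev a b2) + b2 + p * const_mpol (ev a b1) = 0 \<and> ev a b2 = 0"
    using polarize_quadratic[OF fin aff(1,3,2,4) zero, of a] by (auto simp: lift_def a algebra_simps)
  hence "b2 + p * const_mpol (ev a b1) = 0" by auto
  hence b2: "b2 = const_mpol (- ev a b1) * p"
    by (simp add: const_mpol_uminus algebra_simps eq_neg_iff_add_eq_0)
  have "p * (b1 + q * const_mpol (- ev a b1)) = 0"
    using zero unfolding b2 by (simp add: algebra_simps)
  hence "b1 + q * const_mpol (- ev a b1) = 0"
    using lin_indep2_nonzero[OF indep] by (simp only: mult_eq_0_iff) simp
  hence "b1 = - const_mpol (- ev a b1) * q"
    by (simp add: eq_neg_iff_add_eq_0 algebra_simps)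
  thus ?thesis using b2 by blast
qed

lemma cubic_syzygy:
  fixes p q u e w :: "('v::linorder, 'k::field) mpol"
  assumes fin: "finite (UNIV :: 'v set)" and aff: "aff p" "aff q" "aff u" "aff e" "aff w"
    and indep: "lin_indep2 p q" and zero: "p * p * u + p * q * e - q * q * w = 0"
  shows "\<exists>\<alpha> \<beta>. u = - const_mpol \<beta> * q \<and> w = const_mpol \<alpha> * p \<and> e = const_mpol \<beta> * p + const_mpol \<alpha> * q"
proof -
  obtain a where a: "ev a p = 0" "ev a q = 1" using ex_dual_point[OF indep] by blast
  obtain b where b: "ev b q = 0" "ev b p = 1" using ex_dual_point[OF lin_indep2_commute[OF indep]] by blast
  \<comment> \<open>The lifts of \<open>p\<close> and \<open>q\<close> are p and q + t, so the
    coefficient of t^3 gives \<open>ev a w = 0\<close>, and then that of t^2 gives the formula for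
    \<open>w\<close>. At \<open>b\<close> the roles of \<open>p\<close> and \<open>q\<close> are
    exchanged.\<close>
  have w: "w = const_mpol (ev a e) * p"
    using polarize_cubic[OF fin aff zero, of a] by (auto simp: lift_def a algebra_simps)
  have u: "u = - const_mpol (ev b e) * q"
    using polarize_cubic[OF fin aff zero, of b] by (auto simp: lift_def b algebra_simps eq_neg_iff_add_eq_0)
  \<comment> \<open>Inserting \<open>u\<close> and \<open>w\<close> makes the whole syzygy a
    multiple of \<open>p * q\<close>, which can be cancelled in the integral domain.\<close>
  have "p * q * (e - const_mpol (ev b e) * p - const_mpol (ev a e) * q) =
    p * p * u + p * q * e - q * q * w"
    by (subst u, subst w) (simp add: algebra_simps)
  hence "e - const_mpol (ev b e) * p - const_mpol (ev a e) * q = 0"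
    unfolding zero using lin_indep2_nonzero[OF indep] lin_indep2_nonzero[OF lin_indep2_commute[OF indep]]
    by (simp only: mult_eq_0_iff) simp
  hence "e = const_mpol (ev b e) * p + const_mpol (ev a e) * q"
    by (simp add: algebra_simps)
  thus ?thesis using u w by blast
qed

section \<open>Normal form and classification\<close>

definition pivot_at :: "nat \<Rightarrow> nat \<Rightarrow> (nat \<Rightarrow> nat \<Rightarrow> 'k::field) \<Rightarrow> nat \<Rightarrow> bool" where
  "pivot_at m n f k \<longleftrightarrow> f k k = 1 \<and> (\<forall>i<m. i \<noteq> k \<longrightarrow> f i k = 0) \<and> (\<forall>j<n. j \<noteq> k \<longrightarrow> f k j = 0)"

text \<open>One step of Gauss-Jordan elimination for the values at \<open>a\<close>, carried out on
  \<open>N\<close>: a nonzero value is moved to \<open>(k, k)\<close>, then column \<open>k\<close>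
  is cleared by row operations and row \<open>k\<close> by column operations. Earlier pivots survive
  because the values of row \<open>k\<close> in their columns and of column \<open>k\<close> in
  their rows are zero.\<close>

lemma reach_pivot:
  assumes M: "M \<in> carrier_mat m n" and N: "reach M a N"
    and ij: "k \<le> r" "r < m" "k \<le> s" "s < n" and ne: "ev a (N $$ (r, s)) \<noteq> 0"
    and piv: "\<And>l. l < k \<Longrightarrow> pivot_at m n (\<lambda>i j. ev a (N $$ (i, j))) l"
  shows "\<exists>N'. reach M a N' \<and> (\<forall>l\<le>k. pivot_at m n (\<lambda>i j. ev a (N' $$ (i, j))) l)"
proof -
  have k: "k < m" "k < n" using ij by auto
  define \<sigma> where "\<sigma> = id(k := r, r := k)"
  define \<tau> where "\<tau> = id(k := s, s := k)"
  have perm: "\<And>i. i < m \<Longrightarrow> \<sigma> i < m" "\<And>i. i < m \<Longrightarrow> \<sigma> (\<sigma> i) = i"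
    "\<And>j. j < n \<Longrightarrow> \<tau> j < n" "\<And>j. j < n \<Longrightarrow> \<tau> (\<tau> j) = j"
    using ij k by (auto simp: \<sigma>_def \<tau>_def)
  obtain N1 where N1: "reach M a N1" and e1: "\<And>i j. i < m \<Longrightarrow> j < n \<Longrightarrow> N1 $$ (i, j) = N $$ (\<sigma> i, j)"
    using reach_row_perm[OF M N, of \<sigma>] perm(1,2) by blast
  obtain N2 where N2: "reach M a N2" and e2': "\<And>i j. i < m \<Longrightarrow> j < n \<Longrightarrow> N2 $$ (i, j) = N1 $$ (i, \<tau> j)"
    using reach_col_perm[OF M N1, of \<tau>] perm(3,4) by blast
  define e where "e i j = ev a (N2 $$ (i, j))" for i j
  have e2: "e i j = ev a (N $$ (\<sigma> i, \<tau> j))" if "i < m" "j < n" for i j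
    using that ij k e1 e2' by (auto simp: \<tau>_def e_def)
  have ekk: "e k k \<noteq> 0" using ne k by (auto simp: e2 \<sigma>_def \<tau>_def)
  have p2: "e l l = 1" "\<And>i. i < m \<Longrightarrow> i \<noteq> l \<Longrightarrow> e i l = 0" "\<And>j. j < n \<Longrightarrow> j \<noteq> l \<Longrightarrow> e l j = 0"
    if l: "l < k" for l
  proof -
    have fixed: "\<sigma> l = l" "\<tau> l = l" using l ij by (auto simp: \<sigma>_def \<tau>_def)
    have neq: "\<sigma> i \<noteq> l" "\<tau> i \<noteq> l" if "i \<noteq> l" for i using l that ij by (auto simp: \<sigma>_def \<tau>_def)
    have less: "\<And>i. i < m \<Longrightarrow> \<sigma> i < m" "\<And>i. i < n \<Longrightarrow> \<tau> i < n" using ij k by (auto simp: \<sigma>_def \<tau>_def)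
    show "e l l = 1" "\<And>i. i < m \<Longrightarrow> i \<noteq> l \<Longrightarrow> e i l = 0" "\<And>j. j < n \<Longrightarrow> j \<noteq> l \<Longrightarrow> e l j = 0"
      using piv[OF l] l k fixed neq less by (auto simp: pivot_at_def e2)
  qed
  define c where "c i = (if i = k then 1 / e k k else 1)" for i
  define d where "d i = (if i = k then 0 else - e i k / e k k)" for i
  have cd: "\<And>i. i < m \<Longrightarrow> c i \<noteq> 0" "d k = 0" using ekk by (auto simp: c_def d_def)
  obtain N3 where N3: "reach M a N3" and e3: "\<And>i j. i < m \<Longrightarrow> j < n \<Longrightarrow>
      N3 $$ (i, j) = const_mpol (c i) * N2 $$ (i, j) + const_mpol (d i) * N2 $$ (k, j)"
    using reach_row_lincomb[OF M N2, of c d k] cd k by blast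
  define e' where "e' i j = ev a (N3 $$ (i, j))" for i j
  have e': "e' i j = c i * e i j + d i * e k j" if "i < m" "j < n" for i j
    using that by (simp add: e'_def e_def e3 ev_add ev_const_mult)
  have p3: "e' l l = 1" "\<And>i. i < m \<Longrightarrow> i \<noteq> l \<Longrightarrow> e' i l = 0" "\<And>j. j < n \<Longrightarrow> j \<noteq> l \<Longrightarrow> e' l j = 0"
    if l: "l < k" for l
    using p2[OF l] l k by (auto simp: e' c_def d_def)
  have pk: "e' k k = 1" "\<And>i. i < m \<Longrightarrow> i \<noteq> k \<Longrightarrow> e' i k = 0"
    using k ekk by (auto simp: e' c_def d_def)
  \<comment> \<open>By now column \<open>k\<close> has its single nonzero value in row
    \<open>k\<close>, so these column operations change values in row \<open>k\<close> only.\<close>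
  define g where "g j = (if j = k then 0 else - e' k j)" for j
  obtain N4 where N4: "reach M a N4" and e4: "\<And>i j. i < m \<Longrightarrow> j < n \<Longrightarrow>
      N4 $$ (i, j) = const_mpol 1 * N3 $$ (i, j) + const_mpol (g j) * N3 $$ (i, k)"
    using reach_col_lincomb[OF M N3, of "\<lambda>_. 1" g k] k by (auto simp: g_def)
  have e4': "ev a (N4 $$ (i, j)) = e' i j + g j * e' i k" if "i < m" "j < n" for i j
    using that by (simp add: e'_def e4 ev_add ev_const_mult)
  have "pivot_at m n (\<lambda>i j. ev a (N4 $$ (i, j))) l" if l: "l \<le> k" for l
  proof (cases "l = k")
    case True
    thus ?thesis using k pk by (auto simp: pivot_at_def e4' g_def)
  next
    case False
    hence "l < k" using l by simp
    thus ?thesis using k p3[OF \<open>l < k\<close>] by (auto simp: pivot_at_def e4' g_def)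
  qed
  thus ?thesis using N4 by blast
qed

text \<open>After two pivots, the values at \<open>a\<close> are known in the first two rows and
  columns. The lifted 3x3 minor on rows 0, 1, i and columns 0, 1, j is then a cubic polynomial in t,
  and its coefficients yield the block form.\<close>

lemma reach_normal_form:
  fixes M :: "('v::linorder, 'k::field) mpol mat"
  assumes fin: "finite (UNIV :: 'v set)" and M: "M \<in> carrier_mat m n" and N0: "reach M a N0"
  obtains N where "2 \<le> m" "2 \<le> n" "reach M a N" "ev a (N $$ (0, 0)) = 1"
    "\<And>i. 2 \<le> i \<Longrightarrow> i < m \<Longrightarrow> ev a (N $$ (i, 0)) = 0 \<and> ev a (N $$ (i, 1)) = 0"
    "\<And>i j. 2 \<le> i \<Longrightarrow> i < m \<Longrightarrow> 2 \<le> j \<Longrightarrow> j < n \<Longrightarrow> N $$ (i, j) = 0"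
    "\<And>i j. 2 \<le> i \<Longrightarrow> i < m \<Longrightarrow> 2 \<le> j \<Longrightarrow> j < n \<Longrightarrow>
       N $$ (i, 0) * N $$ (0, j) + N $$ (i, 1) * N $$ (1, j) = 0"
proof -
  have nv: "\<not> vanish2 m n (\<lambda>i j. ev a (N $$ (i, j)))" if "reach M a N" for N
    using that M by (auto simp: reach_def)
  have "\<exists>r s. r < m \<and> s < n \<and> ev a (N0 $$ (r, s)) \<noteq> 0"
  proof (rule ccontr)
    assume "\<not> ?thesis"
    hence "vanish2 m n (\<lambda>i j. ev a (N0 $$ (i, j)))" by (auto simp: vanish2_def minor2_def)
    thus False using nv[OF N0] by blast
  qed
  then obtain N1 where N1: "reach M a N1" and "pivot_at m n (\<lambda>i j. ev a (N1 $$ (i, j))) 0"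
    using reach_pivot[OF M N0, of 0] by auto
  hence p1: "ev a (N1 $$ (0, 0)) = 1" "\<And>i. i < m \<Longrightarrow> i \<noteq> 0 \<Longrightarrow> ev a (N1 $$ (i, 0)) = 0"
    "\<And>j. j < n \<Longrightarrow> j \<noteq> 0 \<Longrightarrow> ev a (N1 $$ (0, j)) = 0"
    by (auto simp: pivot_at_def)
  \<comment> \<open>Otherwise (0, 0) would be the only position with a nonzero value, and all 2x2
    minors at \<open>a\<close> would vanish.\<close>
  have "\<exists>r s. 1 \<le> r \<and> r < m \<and> 1 \<le> s \<and> s < n \<and> ev a (N1 $$ (r, s)) \<noteq> 0"
  proof (rule ccontr)
    assume "\<not> ?thesis"
    hence z: "ev a (N1 $$ (r, s)) = (if r = 0 \<and> s = 0 then 1 else 0)" if "r < m" "s < n" for r s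
      using that p1 by (cases "r = 0"; cases "s = 0") auto
    have "vanish2 m n (\<lambda>i j. ev a (N1 $$ (i, j)))" by (auto simp: vanish2_def minor2_def z)
    thus False using nv[OF N1] by blast
  qed
  then obtain r s where rs: "1 \<le> r" "r < m" "1 \<le> s" "s < n" "ev a (N1 $$ (r, s)) \<noteq> 0" by blast
  then obtain N where N: "reach M a N" and piv: "\<forall>l\<le>1. pivot_at m n (\<lambda>i j. ev a (N $$ (i, j))) l"
    using reach_pivot[OF M N1 rs] p1 by (auto simp: pivot_at_def)
  have mn: "0 < m" "1 < m" "2 \<le> m" "0 < n" "1 < n" "2 \<le> n" using rs by auto
  have p: "ev a (N $$ (0, 0)) = 1" "ev a (N $$ (Suc 0, Suc 0)) = 1"
    "\<And>i. i < m \<Longrightarrow> i \<noteq> 0 \<Longrightarrow> ev a (N $$ (i, 0)) = 0" "\<And>i. i < m \<Longrightarrow> i \<noteq> 1 \<Longrightarrow> ev a (N $$ (i, Suc 0)) = 0"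
    "\<And>j. j < n \<Longrightarrow> j \<noteq> 0 \<Longrightarrow> ev a (N $$ (0, j)) = 0" "\<And>j. j < n \<Longrightarrow> j \<noteq> 1 \<Longrightarrow> ev a (N $$ (Suc 0, j)) = 0"
    using piv by (auto simp: pivot_at_def)
  have v3: "vanish3 m n (\<lambda>i j. N $$ (i, j))" and aff: "\<And>i j. i < m \<Longrightarrow> j < n \<Longrightarrow> aff (N $$ (i, j))"
    using N M by (auto simp: reach_def)
  have main: "N $$ (i, j) = 0 \<and> N $$ (i, 0) * N $$ (0, j) + N $$ (i, 1) * N $$ (1, j) = 0"
    if ij: "2 \<le> i" "i < m" "2 \<le> j" "j < n" for i j
  proof -
    have z: "minor3 (\<lambda>i j. lift a (N $$ (i, j))) 0 1 i 0 1 j = 0"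
      by (rule polarize_minor3[OF fin]) (use aff v3 mn ij in \<open>auto simp: vanish3_def\<close>)
    have evs: "ev a (N $$ (Suc 0, 0)) = 0" "ev a (N $$ (0, Suc 0)) = 0" "ev a (N $$ (i, 0)) = 0" "ev a (N $$ (i, Suc 0)) = 0"
      "ev a (N $$ (0, j)) = 0" "ev a (N $$ (Suc 0, j)) = 0"
      using p mn ij by auto
    \<comment> \<open>The coefficients of t^3, t^2 and t give the three equations, each simplified
      by the previous ones.\<close>
    have "ev a (N $$ (i, j)) = 0 \<and> N $$ (i, j) = 0 \<and> N $$ (i, 0) * N $$ (0, j) + N $$ (i, 1) * N $$ (1, j) = 0"
      using z by (auto simp: minor3_def lift_def evs p(1,2) algebra_simps add_eq_0_iff)
    thus ?thesis by blast
  qed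
  show thesis
    by (rule that[OF mn(3,6) N p(1)]) (use p main in auto)
qed

section \<open>Recognizing the first three shapes from vanishing entries\<close>

lemma vanish2_single_col:
  "(\<And>i j. i < m \<Longrightarrow> j < n \<Longrightarrow> j \<noteq> k \<Longrightarrow> f i j = 0) \<Longrightarrow> vanish2 m n f"
  unfolding vanish2_def minor2_def by (metis diff_self mult_zero_left mult_zero_right mult.commute)

lemma vanish2_single_row:
  "(\<And>i j. i < m \<Longrightarrow> j < n \<Longrightarrow> i \<noteq> k \<Longrightarrow> f i j = 0) \<Longrightarrow> vanish2 m n f"
  unfolding vanish2_def minor2_def by (metis diff_self mult_zero_left mult_zero_right mult.commute)

text \<open>If one of the first two columns were zero, at most one nonzero column would remain and
  all 2x2 minors would vanish. The two recognition lemmas that follow rest on the same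
  remark.\<close>

lemma only_first_two_colsI:
  assumes N: "N \<in> carrier_mat m n" and n: "2 \<le> n" and nv: "\<not> vanish2 m n (\<lambda>i j. N $$ (i, j))"
    and z: "\<And>i j. i < m \<Longrightarrow> 2 \<le> j \<Longrightarrow> j < n \<Longrightarrow> N $$ (i, j) = 0"
  shows "only_first_two_cols N"
proof -
  have "col N j \<noteq> 0\<^sub>v m" if j: "j \<in> {0, 1}" for j
  proof
    assume "col N j = 0\<^sub>v m"
    hence 0: "N $$ (i, j) = 0" if "i < m" for i
      using that N n j by (metis carrier_matD index_col index_zero_vec(1) insertE less_le_trans one_less_numeral_iff semiring_norm(76) singletonD zero_less_numeral)
    have "vanish2 m n (\<lambda>i j. N $$ (i, j))"
    \<comment> \<open>\<open>1 - j\<close> is the other one of the indices 0 and 1.\<close>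
    proof (rule vanish2_single_col[of m n "1 - j"])
      fix i l assume il: "i < m" "l < n" "l \<noteq> 1 - j"
      hence "l = j \<or> 2 \<le> l" using j by auto
      thus "N $$ (i, l) = 0" using 0 z il by blast
    qed
    thus False using nv by blast
  qed
  moreover have "col N j = 0\<^sub>v m" if "2 \<le> j" "j < n" for j
    using that N z by (intro eq_vecI) auto
  ultimately have "{j. j < n \<and> col N j \<noteq> 0\<^sub>v m} = {0, 1}"
    using n by (auto simp: not_less_eq_eq numeral_2_eq_2)
  thus ?thesis using N by (auto simp: only_first_two_cols_def)
qed

lemma only_first_two_rowsI:
  assumes N: "N \<in> carrier_mat m n" and m: "2 \<le> m" and nv: "\<not> vanish2 m n (\<lambda>i j. N $$ (i, j))"
    and z: "\<And>i j. 2 \<le> i \<Longrightarrow> i < m \<Longrightarrow> j < n \<Longrightarrow> N $$ (i, j) = 0"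
  shows "only_first_two_rows N"
proof -
  have Nt: "transpose_mat N \<in> carrier_mat n m" using N by simp
  have "vanish2 n m (\<lambda>i j. transpose_mat N $$ (i, j)) = vanish2 n m (\<lambda>i j. N $$ (j, i))"
    by (rule vanish2_cong) (use N in auto)
  hence "only_first_two_cols (transpose_mat N)"
    using nv z N m vanish2_transpose[of n m "\<lambda>i j. N $$ (i, j)"] by (intro only_first_two_colsI[OF Nt]) auto
  thus ?thesis
    using N unfolding only_first_two_cols_def only_first_two_rows_def
    by (simp cong: conj_cong)
qed

lemma only_first_row_and_colI:
  assumes N: "N \<in> carrier_mat m n" and mn: "0 < m" "0 < n" and nv: "\<not> vanish2 m n (\<lambda>i j. N $$ (i, j))"
    and z: "\<And>i j. i < m \<Longrightarrow> j < n \<Longrightarrow> i \<noteq> 0 \<Longrightarrow> j \<noteq> 0 \<Longrightarrow> N $$ (i, j) = 0"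
  shows "only_first_row_and_col N"
proof -
  have "row N 0 \<noteq> 0\<^sub>v n"
  proof
    assume "row N 0 = 0\<^sub>v n"
    hence 0: "N $$ (0, j) = 0" if "j < n" for j
      using that N mn by (metis carrier_matD index_row(1) index_zero_vec(1))
    have "vanish2 m n (\<lambda>i j. N $$ (i, j))"
      by (rule vanish2_single_col[of m n 0]) (metis 0 z)
    thus False using nv by blast
  qed
  moreover have "col N 0 \<noteq> 0\<^sub>v m"
  proof
    assume "col N 0 = 0\<^sub>v m"
    hence 0: "N $$ (i, 0) = 0" if "i < m" for i
      using that N mn by (metis carrier_matD index_col index_zero_vec(1))
    have "vanish2 m n (\<lambda>i j. N $$ (i, j))"
      by (rule vanish2_single_row[of m n 0]) (metis 0 z)
    thus False using nv by blast
  qed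
  ultimately show ?thesis using N mn z by (auto simp: only_first_row_and_col_def)
qed

text \<open>If \<open>\<beta>\<close> is nonzero, the combination in \<open>dep\<close> becomes the
  new column 1. If \<open>\<beta> = 0\<close>, column 0 itself vanishes in the rows from 2 on, and
  the two columns are swapped.\<close>

lemma reach_merge_cols:
  fixes M :: "('v::linorder, 'k::field) mpol mat"
  assumes M: "M \<in> carrier_mat m n" and N: "reach M a N" and n: "2 \<le> n"
    and \<alpha>\<beta>: "\<alpha> \<noteq> 0 \<or> \<beta> \<noteq> 0"
    and dep: "\<And>i. 2 \<le> i \<Longrightarrow> i < m \<Longrightarrow> const_mpol \<alpha> * N $$ (i, 0) + const_mpol \<beta> * N $$ (i, 1) = 0"
  obtains N' where "reach M a N'" "\<And>i. 2 \<le> i \<Longrightarrow> i < m \<Longrightarrow> N' $$ (i, 1) = 0"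
    "\<And>i j. i < m \<Longrightarrow> 2 \<le> j \<Longrightarrow> j < n \<Longrightarrow> N' $$ (i, j) = N $$ (i, j)"
proof (cases "\<beta> = 0")
  case True
  define \<sigma> where "\<sigma> = id(0 := 1, 1 := 0 :: nat)"
  have \<sigma>: "\<And>j. j < n \<Longrightarrow> \<sigma> j < n" "\<And>j. j < n \<Longrightarrow> \<sigma> (\<sigma> j) = j" using n by (auto simp: \<sigma>_def)
  obtain N' where N': "reach M a N'" and e: "\<And>i j. i < m \<Longrightarrow> j < n \<Longrightarrow> N' $$ (i, j) = N $$ (i, \<sigma> j)"
    using reach_col_perm[OF M N, of \<sigma>] \<sigma> by blast
  show ?thesis
    using True \<alpha>\<beta> dep n by (intro that[OF N']) (auto simp: e \<sigma>_def)
next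
  case False
  define c where "c j = (if j = 1 then \<beta> else 1)" for j :: nat
  define d where "d j = (if j = 1 then \<alpha> else 0)" for j :: nat
  have cd: "\<And>j. j < n \<Longrightarrow> c j \<noteq> 0" "d 0 = 0" "0 < n" using False n by (auto simp: c_def d_def)
  obtain N' where N': "reach M a N'" and e: "\<And>i j. i < m \<Longrightarrow> j < n \<Longrightarrow>
      N' $$ (i, j) = const_mpol (c j) * N $$ (i, j) + const_mpol (d j) * N $$ (i, 0)"
    using reach_col_lincomb[where c = c and d = d, OF M N cd] by blast
  show ?thesis
    using dep n by (intro that[OF N']) (auto simp: e c_def d_def add.commute)
qed

lemma reach_merge_rows:
  fixes M :: "('v::linorder, 'k::field) mpol mat"
  assumes M: "M \<in> carrier_mat m n" and N: "reach M a N" and m: "2 \<le> m"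
    and \<alpha>\<beta>: "\<alpha> \<noteq> 0 \<or> \<beta> \<noteq> 0"
    and dep: "\<And>j. 2 \<le> j \<Longrightarrow> j < n \<Longrightarrow> const_mpol \<alpha> * N $$ (0, j) + const_mpol \<beta> * N $$ (1, j) = 0"
  obtains N' where "reach M a N'" "\<And>j. 2 \<le> j \<Longrightarrow> j < n \<Longrightarrow> N' $$ (1, j) = 0"
    "\<And>i j. 2 \<le> i \<Longrightarrow> i < m \<Longrightarrow> j < n \<Longrightarrow> N' $$ (i, j) = N $$ (i, j)"
proof -
  have Nc: "N \<in> carrier_mat m n" using reach_carrier[OF M N] .
  have Mt: "transpose_mat M \<in> carrier_mat n m" using M by simp
  have dep': "const_mpol \<alpha> * transpose_mat N $$ (j, 0) + const_mpol \<beta> * transpose_mat N $$ (j, 1) = 0"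
    if "2 \<le> j" "j < n" for j using dep[OF that] that Nc m by simp
  obtain N' where N': "reach (transpose_mat M) a N'" and e: "\<And>i. 2 \<le> i \<Longrightarrow> i < n \<Longrightarrow> N' $$ (i, 1) = 0"
    "\<And>i j. i < n \<Longrightarrow> 2 \<le> j \<Longrightarrow> j < m \<Longrightarrow> N' $$ (i, j) = transpose_mat N $$ (i, j)"
    using reach_merge_cols[OF Mt reach_transpose[OF M N] m \<alpha>\<beta> dep'] by blast
  have "reach M a (transpose_mat N')" using reach_transpose[OF Mt N'] by simp
  moreover have "N' \<in> carrier_mat n m" using reach_carrier[OF Mt N'] .
  ultimately show thesis using e Nc m by (intro that[of "transpose_mat N'"]) auto
qed

text \<open>The bordering entries have the antisymmetric shape up to interchanging the first two rows. The
  coefficients of the syzygy given by the determinant tell which multiples of the third row clear the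
  upper left block.\<close>

lemma reach_skew:
  fixes M :: "('v::linorder, 'k::field) mpol mat"
  assumes fin: "finite (UNIV :: 'v set)" and M: "M \<in> carrier_mat m n" and N: "reach M a N"
    and mn: "3 \<le> m" "3 \<le> n" and indep: "lin_indep2 p q" and ev: "ev a p = 0" "ev a q = 0" "ev a (N $$ (0, 0)) = 1"
    and border: "N $$ (2, 0) = p" "N $$ (2, 1) = q" "N $$ (0, 2) = - q" "N $$ (1, 2) = p" "N $$ (2, 2) = 0"
    and outside: "\<And>i j. i < m \<Longrightarrow> j < n \<Longrightarrow> 3 \<le> i \<or> 3 \<le> j \<Longrightarrow> N $$ (i, j) = 0"
  obtains N' where "reach M a N'" "only_antisymmetric_leading3 N'"
proof -
  have lt: "0 < m" "1 < m" "2 < m" "0 < n" "1 < n" "2 < n" using mn by auto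
  have aff: "\<And>i j. i < m \<Longrightarrow> j < n \<Longrightarrow> aff (N $$ (i, j))" and v3: "vanish3 m n (\<lambda>i j. N $$ (i, j))"
    using N M by (auto simp: reach_def)
  have apq: "aff p" "aff q" using aff lt border(1,2) by metis+
  have "minor3 (\<lambda>i j. N $$ (i, j)) 0 1 2 0 1 2 = 0" using v3 lt by (simp add: vanish3_def)
  \<comment> \<open>Expanding the determinant of the leading block along its border gives a cubic
    syzygy of \<open>p\<close> and \<open>q\<close>.\<close>
  hence "p * p * N $$ (0, 1) + p * q * (N $$ (1, 1) - N $$ (0, 0)) - q * q * N $$ (1, 0) = 0"
    by (simp add: minor3_def border[unfolded One_nat_def] algebra_simps)
  then obtain \<alpha> \<beta> where syz: "N $$ (0, 1) = - const_mpol \<beta> * q" "N $$ (1, 0) = const_mpol \<alpha> * p"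
    "N $$ (1, 1) - N $$ (0, 0) = const_mpol \<beta> * p + const_mpol \<alpha> * q"
    using cubic_syzygy[OF fin apq _ _ _ indep] aff lt aff_diff by metis
  define \<sigma> where "\<sigma> = id(0 := 1, 1 := 0 :: nat)"
  have \<sigma>: "\<And>j. j < m \<Longrightarrow> \<sigma> j < m" "\<And>j. j < m \<Longrightarrow> \<sigma> (\<sigma> j) = j" using mn by (auto simp: \<sigma>_def)
  obtain N1 where N1: "reach M a N1" and e1: "\<And>i j. i < m \<Longrightarrow> j < n \<Longrightarrow> N1 $$ (i, j) = N $$ (\<sigma> i, j)"
    using reach_row_perm[OF M N, of \<sigma>] \<sigma> by blast
  \<comment> \<open>After the swap, the border column starts with \<open>p\<close>,
    \<open>- q\<close>; the sign in row 0 makes it the negative of the border row. Adding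
    \<open>\<alpha>\<close> and \<open>\<beta>\<close> times row 2 then clears the first two
    diagonal entries.\<close>
  define c where "c j = (if j = 0 then - 1 else 1 :: 'k)" for j :: nat
  define d where "d j = (if j = 0 then \<alpha> else if j = 1 then \<beta> else 0)" for j :: nat
  have cd: "\<And>j. j < m \<Longrightarrow> c j \<noteq> 0" "d 2 = 0" by (auto simp: c_def d_def)
  obtain N2 where N2: "reach M a N2" and e2: "\<And>i j. i < m \<Longrightarrow> j < n \<Longrightarrow>
      N2 $$ (i, j) = const_mpol (c i) * N1 $$ (i, j) + const_mpol (d i) * N1 $$ (2, j)"
    using reach_row_lincomb[where c = c and d = d, OF M N1 cd lt(3)] by blast
  have N2c: "N2 \<in> carrier_mat m n" using reach_carrier[OF M N2] .
  define r where "r = N $$ (0, 0) + const_mpol \<beta> * p"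
  have N11: "N $$ (1, 1) = r + const_mpol \<alpha> * q" using syz(3) by (simp add: r_def algebra_simps)
  have rows: "N2 $$ (0, j) = - N $$ (1, j) + const_mpol \<alpha> * N $$ (2, j)"
    "N2 $$ (1, j) = N $$ (0, j) + const_mpol \<beta> * N $$ (2, j)"
    "N2 $$ (2, j) = N $$ (2, j)" if "j < n" for j
    using that lt by (simp_all add: e1 e2 c_def d_def \<sigma>_def const_mpol_uminus)
  have ent: "N2 $$ (0, 0) = 0" "N2 $$ (0, 1) = - r" "N2 $$ (0, 2) = - p"
    "N2 $$ (1, 0) = r" "N2 $$ (1, 1) = 0" "N2 $$ (1, 2) = - q"
    "N2 $$ (2, 0) = p" "N2 $$ (2, 1) = q" "N2 $$ (2, 2) = 0"
    using lt by (simp_all only: rows border syz(1,2) N11) (simp_all add: r_def)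
  have out: "N2 $$ (i, j) = 0" if ij: "i < m" "j < n" "3 \<le> i \<or> 3 \<le> j" for i j
  proof (cases "3 \<le> j")
    case True
    thus ?thesis using ij lt \<sigma> outside by (simp add: e1 e2)
  next
    case False
    thus ?thesis using ij lt outside by (simp add: e1 e2 c_def d_def \<sigma>_def)
  qed
  have less3: "i = 0 \<or> i = 1 \<or> i = 2" if "i < 3" for i :: nat using that by auto
  have l3: "leading3 N2 $$ (i, j) = N2 $$ (i, j)" if "i < 3" "j < 3" for i j
    using that by (simp add: leading3_def)
  \<comment> \<open>\<open>p\<close> and \<open>q\<close> vanish at \<open>a\<close> while
    \<open>r\<close> does not, which separates \<open>r\<close> from the span of \<open>p\<close>
    and \<open>q\<close>.\<close>
  have evr: "ev a r = 1" by (simp add: r_def ev_add ev_const_mult ev)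
  have "antisymmetric_mat (leading3 N2)"
    unfolding antisymmetric_mat_def
  proof (rule eq_matI)
    fix i j assume "i < dim_row (- leading3 N2)" "j < dim_col (- leading3 N2)"
    hence ij: "i < 3" "j < 3" by (auto simp: leading3_def)
    have "N2 $$ (j, i) = - N2 $$ (i, j)"
      using less3[OF ij(1)] less3[OF ij(2)] by (elim disjE) (simp_all only: ent, simp_all)
    thus "transpose_mat (leading3 N2) $$ (i, j) = (- leading3 N2) $$ (i, j)"
      using ij by (simp add: leading3_def)
  qed (simp_all add: leading3_def)
  moreover have "leading3 N2 $$ (i, i) = 0" if "i < 3" for i
    using less3[OF that] by (elim disjE) (simp_all add: l3 ent[unfolded One_nat_def])
  moreover have "lin_indep3 r p q"
    unfolding lin_indep3_def
  proof (intro allI impI)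
    fix x y z assume eq: "const_mpol x * r + const_mpol y * p + const_mpol z * q = 0"
    have "ev a (const_mpol x * r + const_mpol y * p + const_mpol z * q) = x"
      by (simp add: ev_add ev_const_mult ev evr)
    hence "x = 0" using eq by simp
    thus "x = 0 \<and> y = 0 \<and> z = 0" using eq indep by (simp add: lin_indep2_def)
  qed
  hence "lin_indep3 (leading3 N2 $$ (1, 0)) (leading3 N2 $$ (2, 0)) (leading3 N2 $$ (2, 1))"
    by (simp add: l3 ent[unfolded One_nat_def])
  ultimately have "only_antisymmetric_leading3 N2"
    using N2c mn out unfolding only_antisymmetric_leading3_def by (auto simp: not_less)
  thus thesis using N2 by (rule that[rotated])
qed

lemma reach_classification:
  fixes M :: "('v::linorder, 'k::field) mpol mat"
  assumes fin: "finite (UNIV :: 'v set)" and M: "M \<in> carrier_mat m n" and N0: "reach M a N0"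
  obtains N where "reach M a N" "only_first_two_cols N \<or> only_first_two_rows N \<or>
    only_first_row_and_col N \<or> only_antisymmetric_leading3 N"
proof -
  obtain N where mn: "2 \<le> m" "2 \<le> n" and N: "reach M a N" and ev00: "ev a (N $$ (0, 0)) = 1"
    and evc: "\<And>i. 2 \<le> i \<Longrightarrow> i < m \<Longrightarrow> ev a (N $$ (i, 0)) = 0 \<and> ev a (N $$ (i, 1)) = 0"
    and D: "\<And>i j. 2 \<le> i \<Longrightarrow> i < m \<Longrightarrow> 2 \<le> j \<Longrightarrow> j < n \<Longrightarrow> N $$ (i, j) = 0"
    and CB: "\<And>i j. 2 \<le> i \<Longrightarrow> i < m \<Longrightarrow> 2 \<le> j \<Longrightarrow> j < n \<Longrightarrow>
       N $$ (i, 0) * N $$ (0, j) + N $$ (i, 1) * N $$ (1, j) = 0"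
    by (rule reach_normal_form[OF fin M N0]) (rule that)
  note finish = that
  have lt: "0 < m" "1 < m" "0 < n" "1 < n" using mn by auto
  have less2: "i < 2 \<longleftrightarrow> i = 0 \<or> i = 1" for i :: nat by auto
  have cols: ?thesis if X: "reach M a X"
    and z: "\<And>i j. i < m \<Longrightarrow> 2 \<le> j \<Longrightarrow> j < n \<Longrightarrow> X $$ (i, j) = 0" for X
  proof -
    have "\<not> vanish2 m n (\<lambda>i j. X $$ (i, j))" using X M by (simp add: reach_def)
    from only_first_two_colsI[OF reach_carrier[OF M X] mn(2) this z] show ?thesis using finish[OF X] by blast
  qed
  have rows: ?thesis if X: "reach M a X"
    and z: "\<And>i j. 2 \<le> i \<Longrightarrow> i < m \<Longrightarrow> j < n \<Longrightarrow> X $$ (i, j) = 0" for X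
  proof -
    have "\<not> vanish2 m n (\<lambda>i j. X $$ (i, j))" using X M by (simp add: reach_def)
    from only_first_two_rowsI[OF reach_carrier[OF M X] mn(1) this z] show ?thesis using finish[OF X] by blast
  qed
  have colsB: ?thesis if X: "reach M a X"
    and z: "\<And>i j. 2 \<le> i \<Longrightarrow> i < m \<Longrightarrow> 2 \<le> j \<Longrightarrow> j < n \<Longrightarrow> X $$ (i, j) = 0"
    and B: "\<And>j. 2 \<le> j \<Longrightarrow> j < n \<Longrightarrow> X $$ (0, j) = 0 \<and> X $$ (1, j) = 0" for X
  proof (rule cols[OF X])
    fix i j assume "i < m" "2 \<le> j" "j < n"
    thus "X $$ (i, j) = 0" using z B less2[of i] not_le by metis
  qed
  have rowsC: ?thesis if X: "reach M a X"
    and z: "\<And>i j. 2 \<le> i \<Longrightarrow> i < m \<Longrightarrow> 2 \<le> j \<Longrightarrow> j < n \<Longrightarrow> X $$ (i, j) = 0"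
    and C: "\<And>i. 2 \<le> i \<Longrightarrow> i < m \<Longrightarrow> X $$ (i, 0) = 0 \<and> X $$ (i, 1) = 0" for X
  proof (rule rows[OF X])
    fix i j assume "2 \<le> i" "i < m" "j < n"
    thus "X $$ (i, j) = 0" using z C less2[of j] not_le by metis
  qed
  show ?thesis
  proof (cases "(\<forall>j. 2 \<le> j \<longrightarrow> j < n \<longrightarrow> N $$ (0, j) = 0 \<and> N $$ (1, j) = 0) \<or>
      (\<forall>i. 2 \<le> i \<longrightarrow> i < m \<longrightarrow> N $$ (i, 0) = 0 \<and> N $$ (i, 1) = 0)")
    case True
    thus ?thesis
    proof
      assume "\<forall>j. 2 \<le> j \<longrightarrow> j < n \<longrightarrow> N $$ (0, j) = 0 \<and> N $$ (1, j) = 0"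
      thus ?thesis using colsB[OF N D] by blast
    next
      assume "\<forall>i. 2 \<le> i \<longrightarrow> i < m \<longrightarrow> N $$ (i, 0) = 0 \<and> N $$ (i, 1) = 0"
      thus ?thesis using rowsC[OF N D] by blast
    qed
  next
    case False
    \<comment> \<open>Column \<open>s\<close> of the upper right block and row \<open>t\<close> of
      the lower left block are nonzero. By \<open>CB\<close>, each row of the latter is orthogonal
      to each column of the former.\<close>
    then obtain s t where s: "2 \<le> s" "s < n" "N $$ (0, s) \<noteq> 0 \<or> N $$ (1, s) \<noteq> 0"
      and t: "2 \<le> t" "t < m" "N $$ (t, 0) \<noteq> 0 \<or> N $$ (t, 1) \<noteq> 0" by blast
    show ?thesis
    proof (cases "lin_indep2 (N $$ (t, 0)) (N $$ (t, 1))")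
      case False
      then obtain \<alpha> \<beta> where ab: "\<alpha> \<noteq> 0 \<or> \<beta> \<noteq> 0"
        and dep: "const_mpol \<alpha> * N $$ (t, 0) + const_mpol \<beta> * N $$ (t, 1) = 0"
        by (auto simp: lin_indep2_def)
      \<comment> \<open>Row \<open>t\<close> is nonzero and orthogonal both to
        \<open>(\<alpha>, \<beta>)\<close> and to column \<open>j\<close>, so these two are
        proportional over the fraction field. Multiplying by a nonzero entry of row \<open>t\<close>
        avoids the division.\<close>
      have B: "const_mpol \<beta> * N $$ (0, j) + const_mpol (- \<alpha>) * N $$ (1, j) = 0" if j: "2 \<le> j" "j < n" for j
      proof -
        let ?X = "const_mpol \<beta> * N $$ (0, j) + const_mpol (- \<alpha>) * N $$ (1, j)"
        have "N $$ (t, 0) * ?X = const_mpol \<beta> * (N $$ (t, 0) * N $$ (0, j) + N $$ (t, 1) * N $$ (1, j))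
            - (const_mpol \<alpha> * N $$ (t, 0) + const_mpol \<beta> * N $$ (t, 1)) * N $$ (1, j)"
          by (simp add: algebra_simps const_mpol_uminus)
        hence 1: "N $$ (t, 0) * ?X = 0" unfolding dep CB[OF t(1,2) j] by simp
        have "N $$ (t, 1) * ?X = (const_mpol \<alpha> * N $$ (t, 0) + const_mpol \<beta> * N $$ (t, 1)) * N $$ (0, j)
            - const_mpol \<alpha> * (N $$ (t, 0) * N $$ (0, j) + N $$ (t, 1) * N $$ (1, j))"
          by (simp add: algebra_simps const_mpol_uminus)
        hence 2: "N $$ (t, 1) * ?X = 0" unfolding dep CB[OF t(1,2) j] by simp
        show ?thesis using 1 2 t(3) by (metis mult_eq_0_iff)
      qed
      \<comment> \<open>The same argument with column \<open>s\<close> in place of row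
        \<open>t\<close> extends the dependency to all rows.\<close>
      have C: "const_mpol \<alpha> * N $$ (i, 0) + const_mpol \<beta> * N $$ (i, 1) = 0" if i: "2 \<le> i" "i < m" for i
      proof -
        let ?X = "const_mpol \<alpha> * N $$ (i, 0) + const_mpol \<beta> * N $$ (i, 1)"
        have "N $$ (0, s) * ?X = const_mpol \<alpha> * (N $$ (i, 0) * N $$ (0, s) + N $$ (i, 1) * N $$ (1, s))
            + N $$ (i, 1) * (const_mpol \<beta> * N $$ (0, s) + const_mpol (- \<alpha>) * N $$ (1, s))"
          by (simp add: algebra_simps const_mpol_uminus)
        hence 1: "N $$ (0, s) * ?X = 0" unfolding B[OF s(1,2)] CB[OF i s(1,2)] by simp
        have "N $$ (1, s) * ?X = const_mpol \<beta> * (N $$ (i, 0) * N $$ (0, s) + N $$ (i, 1) * N $$ (1, s))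
            - N $$ (i, 0) * (const_mpol \<beta> * N $$ (0, s) + const_mpol (- \<alpha>) * N $$ (1, s))"
          by (simp add: algebra_simps const_mpol_uminus)
        hence 2: "N $$ (1, s) * ?X = 0" unfolding B[OF s(1,2)] CB[OF i s(1,2)] by simp
        show ?thesis using 1 2 s(3) by (metis mult_eq_0_iff)
      qed
      obtain N1 where N1: "reach M a N1" and N1z: "\<And>i. 2 \<le> i \<Longrightarrow> i < m \<Longrightarrow> N1 $$ (i, 1) = 0"
        and N1e: "\<And>i j. i < m \<Longrightarrow> 2 \<le> j \<Longrightarrow> j < n \<Longrightarrow> N1 $$ (i, j) = N $$ (i, j)"
        using reach_merge_cols[OF M N mn(2) ab C] by blast
      have B1: "const_mpol \<beta> * N1 $$ (0, j) + const_mpol (- \<alpha>) * N1 $$ (1, j) = 0" if "2 \<le> j" "j < n" for j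
        using B[OF that] N1e[OF lt(1) that] N1e[OF lt(2) that] by simp
      have ab1: "\<beta> \<noteq> 0 \<or> - \<alpha> \<noteq> 0" using ab by auto
      obtain N2 where N2: "reach M a N2" and N2z: "\<And>j. 2 \<le> j \<Longrightarrow> j < n \<Longrightarrow> N2 $$ (1, j) = 0"
        and N2e: "\<And>i j. 2 \<le> i \<Longrightarrow> i < m \<Longrightarrow> j < n \<Longrightarrow> N2 $$ (i, j) = N1 $$ (i, j)"
        using reach_merge_rows[OF M N1 mn(1) ab1 B1] by blast
      have D2: "N2 $$ (i, j) = 0" if "2 \<le> i" "i < m" "2 \<le> j" "j < n" for i j
        using N2e[OF that(1,2,4)] N1e[OF that(2,3,4)] D[OF that] by simp
      have C2: "N2 $$ (i, 1) = 0" if "2 \<le> i" "i < m" for i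
        using N2e[OF that lt(4)] N1z[OF that] by simp
      show ?thesis
      proof (cases "(\<forall>i. 2 \<le> i \<longrightarrow> i < m \<longrightarrow> N2 $$ (i, 0) = 0) \<or> (\<forall>j. 2 \<le> j \<longrightarrow> j < n \<longrightarrow> N2 $$ (0, j) = 0)")
        case True
        thus ?thesis
        proof
          assume "\<forall>i. 2 \<le> i \<longrightarrow> i < m \<longrightarrow> N2 $$ (i, 0) = 0"
          thus ?thesis using C2 rowsC[OF N2 D2] by blast
        next
          assume "\<forall>j. 2 \<le> j \<longrightarrow> j < n \<longrightarrow> N2 $$ (0, j) = 0"
          thus ?thesis using N2z colsB[OF N2 D2] by blast
        qed
      next
        case False
        then obtain u v where u: "2 \<le> u" "u < m" "N2 $$ (u, 0) \<noteq> 0" and v: "2 \<le> v" "v < n" "N2 $$ (0, v) \<noteq> 0"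
          by blast
        \<comment> \<open>The zeros found so far make this minor, up to sign, the product of its
          antidiagonal entries.\<close>
        have "minor3 (\<lambda>i j. N2 $$ (i, j)) 0 1 u 0 1 v = 0"
          using N2 M lt u v by (auto simp: reach_def vanish3_def)
        hence "N2 $$ (0, v) * N2 $$ (1, 1) * N2 $$ (u, 0) = 0"
          using C2[OF u(1,2)] N2z[OF v(1,2)] D2[OF u(1,2) v(1,2)] by (simp add: minor3_def mult.assoc)
        hence N211: "N2 $$ (1, 1) = 0" using u v by simp
        have nv: "\<not> vanish2 m n (\<lambda>i j. N2 $$ (i, j))" using N2 M by (simp add: reach_def)
        have "only_first_row_and_col N2"
        proof (rule only_first_row_and_colI[OF reach_carrier[OF M N2] lt(1,3) nv])
          fix i j assume ij: "i < m" "j < n" "i \<noteq> 0" "j \<noteq> 0"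
          hence "i = 1 \<or> 2 \<le> i" "j = 1 \<or> 2 \<le> j" by auto
          thus "N2 $$ (i, j) = 0" using ij N211 D2 C2 N2z by blast
        qed
        thus ?thesis using that[OF N2] by blast
      qed
    next
      case True
      let ?p = "N $$ (t, 0)" and ?q = "N $$ (t, 1)"
      have aff: "\<And>i j. i < m \<Longrightarrow> j < n \<Longrightarrow> aff (N $$ (i, j))" using N M by (simp add: reach_def)
      have "\<exists>\<mu>. N $$ (0, j) = - const_mpol \<mu> * ?q \<and> N $$ (1, j) = const_mpol \<mu> * ?p" if "2 \<le> j" "j < n" for j
        by (rule linear_syzygy[OF fin _ _ _ _ True CB]) (use that t lt aff in auto)
      then obtain \<mu> where \<mu>: "\<And>j. 2 \<le> j \<Longrightarrow> j < n \<Longrightarrow> N $$ (0, j) = - const_mpol (\<mu> j) * ?q \<and> N $$ (1, j) = const_mpol (\<mu> j) * ?p"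
        by metis
      have \<mu>s: "\<mu> s \<noteq> 0" using \<mu>[OF s(1,2)] s(3) by auto
      \<comment> \<open>Column \<open>s\<close> is \<open>\<mu> s\<close> times the vector
        \<open>(- ?q, ?p)\<close>. Cancelling the nonzero constant turns orthogonality to it into a
        linear syzygy of \<open>?p\<close> and \<open>?q\<close>.\<close>
      have "\<exists>\<nu>. N $$ (i, 1) = - const_mpol \<nu> * ?q \<and> - N $$ (i, 0) = const_mpol \<nu> * ?p" if i: "2 \<le> i" "i < m" for i
      proof (rule linear_syzygy[OF fin _ _ _ _ True])
        have "const_mpol (\<mu> s) * (?p * N $$ (i, 1) + ?q * - N $$ (i, 0)) =
          N $$ (i, 0) * N $$ (0, s) + N $$ (i, 1) * N $$ (1, s)"
          using \<mu>[OF s(1,2)] by (simp add: algebra_simps)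
        thus "?p * N $$ (i, 1) + ?q * - N $$ (i, 0) = 0" unfolding CB[OF i s(1,2)] using \<mu>s
          by (simp only: mult_eq_0_iff const_mpol_eq_0_iff) simp
      qed (use i t lt aff aff_uminus in auto)
      then obtain \<nu> where \<nu>: "\<And>i. 2 \<le> i \<Longrightarrow> i < m \<Longrightarrow> N $$ (i, 1) = - const_mpol (\<nu> i) * ?q \<and> - N $$ (i, 0) = const_mpol (\<nu> i) * ?p"
        by metis
      have \<nu>': "N $$ (i, 0) + const_mpol (\<nu> i) * ?p = 0" "N $$ (i, 1) + const_mpol (\<nu> i) * ?q = 0"
        if "2 \<le> i" "i < m" for i using \<nu>[OF that] by (auto simp: minus_equation_iff[of "N $$ (i, 0)"] dest: sym)
      \<comment> \<open>Row \<open>t\<close> and column \<open>s\<close> become row 2 and column 2,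
        the pivots for clearing the other bordering rows and columns.\<close>
      define \<sigma> where "\<sigma> = id(2 := t, t := 2)"
      define \<tau> where "\<tau> = id(2 := s, s := 2)"
      have mn3: "3 \<le> m" "3 \<le> n" "2 < m" "2 < n" using s t by auto
      have \<sigma>: "\<And>i. i < m \<Longrightarrow> \<sigma> i < m" "\<And>i. i < m \<Longrightarrow> \<sigma> (\<sigma> i) = i"
        and \<tau>: "\<And>j. j < n \<Longrightarrow> \<tau> j < n" "\<And>j. j < n \<Longrightarrow> \<tau> (\<tau> j) = j"
        and ge2: "\<And>i. 2 \<le> i \<Longrightarrow> 2 \<le> \<sigma> i" "\<And>j. 2 \<le> j \<Longrightarrow> 2 \<le> \<tau> j"
        and vals: "\<sigma> 2 = t" "\<tau> 2 = s" "\<sigma> 0 = 0" "\<sigma> 1 = 1" "\<tau> 0 = 0" "\<tau> 1 = 1"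
        using s t mn3 by (auto simp: \<sigma>_def \<tau>_def)
      obtain N1 where N1: "reach M a N1" and e1: "\<And>i j. i < m \<Longrightarrow> j < n \<Longrightarrow> N1 $$ (i, j) = N $$ (\<sigma> i, j)"
        using reach_row_perm[OF M N, of \<sigma>] \<sigma> by blast
      obtain N2 where N2: "reach M a N2" and e2': "\<And>i j. i < m \<Longrightarrow> j < n \<Longrightarrow> N2 $$ (i, j) = N1 $$ (i, \<tau> j)"
        using reach_col_perm[OF M N1, of \<tau>] \<tau> by blast
      have e2: "N2 $$ (i, j) = N $$ (\<sigma> i, \<tau> j)" if "i < m" "j < n" for i j
        using that \<tau> e1 e2' by simp
      \<comment> \<open>The sign is positive because, by \<open>\<nu>'\<close>, row
        \<open>\<sigma> i\<close> of the lower left block is \<open>- \<nu> (\<sigma> i)\<close>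
        times \<open>(?p, ?q)\<close>.\<close>
      define d where "d i = (if 3 \<le> i then \<nu> (\<sigma> i) else 0)" for i
      have "d 2 = 0" by (simp add: d_def)
      then obtain N3 where N3: "reach M a N3" and e3: "\<And>i j. i < m \<Longrightarrow> j < n \<Longrightarrow>
          N3 $$ (i, j) = const_mpol 1 * N2 $$ (i, j) + const_mpol (d i) * N2 $$ (2, j)"
        using reach_row_lincomb[where c = "\<lambda>_. 1" and d = d and k = 2, OF M N2 _ _ mn3(3)] by auto
      \<comment> \<open>Scaling by \<open>1 / \<mu> s\<close> turns the top of column 2 into
        \<open>- ?q\<close>, \<open>?p\<close>, 0, the border that \<open>reach_skew\<close>
        expects.\<close>
      define c where "c j = (if j = 2 then 1 / \<mu> s else 1)" for j :: nat
      define g where "g j = (if 3 \<le> j then - \<mu> (\<tau> j) / \<mu> s else 0)" for j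
      have cg: "\<And>j. j < n \<Longrightarrow> c j \<noteq> 0" "g 2 = 0" using \<mu>s by (auto simp: c_def g_def)
      obtain N4 where N4: "reach M a N4" and e4: "\<And>i j. i < m \<Longrightarrow> j < n \<Longrightarrow>
          N4 $$ (i, j) = const_mpol (c j) * N3 $$ (i, j) + const_mpol (g j) * N3 $$ (i, 2)"
        using reach_col_lincomb[where c = c and d = g, OF M N3 cg mn3(4)] by blast
      have N3low: "N3 $$ (i, j) = 0" if ij: "3 \<le> i" "i < m" "j < n" for i j
      proof -
        have i: "2 \<le> \<sigma> i" "\<sigma> i < m" using ij ge2 \<sigma> by auto
        have N3: "N3 $$ (i, j) = N $$ (\<sigma> i, \<tau> j) + const_mpol (\<nu> (\<sigma> i)) * N $$ (t, \<tau> j)"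
          using ij mn3 by (simp add: e3 e2 d_def vals)
        show ?thesis
        proof (cases "2 \<le> j")
          case True
          thus ?thesis using N3 i ij t ge2 \<tau> D by simp
        next
          case False
          hence "j = 0 \<or> j = 1" by auto
          thus ?thesis using N3 \<nu>'[OF i] vals by auto
        qed
      qed
      have N3up: "N3 $$ (i, j) = N $$ (\<sigma> i, \<tau> j)" if "i < 3" "j < n" for i j
        using that mn3 by (simp add: e3 e2 d_def)
      have N3c2: "N3 $$ (0, 2) = - const_mpol (\<mu> s) * ?q" "N3 $$ (1, 2) = const_mpol (\<mu> s) * ?p" "N3 $$ (2, 2) = 0"
        using N3up[of 0 2] N3up[of 1 2] N3up[of 2 2] \<mu>[OF s(1,2)] D[OF t(1,2) s(1,2)] mn3 by (simp_all add: vals vals[unfolded One_nat_def])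
      have inv: "const_mpol (1 / \<mu> s) * (const_mpol (\<mu> s) * x) = x" for x :: "('v, 'k) mpol"
        using \<mu>s by (simp add: mult.assoc[symmetric] const_mpol_mult[symmetric])
      have cancel: "const_mpol y * x + const_mpol (- y / \<mu> s) * (const_mpol (\<mu> s) * x) = 0" for x :: "('v, 'k) mpol" and y
        using \<mu>s by (simp add: mult.assoc[symmetric] const_mpol_mult[symmetric] const_mpol_uminus)
      have N4left: "N4 $$ (i, j) = N $$ (\<sigma> i, j)" if "i < 3" "j \<in> {0, 1}" for i j
        using that N3up[of i j] mn3 lt vals by (auto simp: e4 c_def g_def)
      have N4right: "N4 $$ (0, j) = 0" "N4 $$ (1, j) = 0" "N4 $$ (2, j) = 0" if j: "3 \<le> j" "j < n" for j
      proof -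
        have tj: "2 \<le> \<tau> j" "\<tau> j < n" using j ge2 \<tau> by auto
        show "N4 $$ (0, j) = 0"
          using j lt mn3 N3up[of 0 j] N3c2(1) \<mu>[OF tj] vals cancel[of "\<mu> (\<tau> j)" "- ?q"] by (simp add: e4 c_def g_def)
        show "N4 $$ (1, j) = 0"
          using j lt mn3 N3up[of 1 j] N3c2(2) \<mu>[OF tj] vals cancel[of "\<mu> (\<tau> j)" ?p] by (simp add: e4 c_def g_def)
        show "N4 $$ (2, j) = 0"
          using j lt mn3 N3up[of 2 j] N3c2(3) D[OF t(1,2) tj] vals by (simp add: e4 c_def g_def)
      qed
      have N4c2: "N4 $$ (0, 2) = - ?q" "N4 $$ (1, 2) = ?p" "N4 $$ (2, 2) = 0"
        using lt mn3 inv[of "- ?q"] inv[of ?p] by (simp_all add: e4 c_def g_def N3c2[unfolded One_nat_def])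
      have out: "N4 $$ (i, j) = 0" if ij: "i < m" "j < n" "3 \<le> i \<or> 3 \<le> j" for i j
      proof (cases "3 \<le> i")
        case True
        thus ?thesis using ij mn3 N3low by (simp add: e4)
      next
        case False
        hence "i = 0 \<or> i = 1 \<or> i = 2" "3 \<le> j" using ij by auto
        thus ?thesis using N4right ij by blast
      qed
      have left: "N4 $$ (2, 0) = ?p" "N4 $$ (2, 1) = ?q" "N4 $$ (0, 0) = N $$ (0, 0)"
        using N4left[of 2 0] N4left[of 2 1] N4left[of 0 0] vals by auto
      have evs: "ev a ?p = 0" "ev a ?q = 0" "ev a (N4 $$ (0, 0)) = 1" using evc[OF t(1,2)] left(3) ev00 by auto
      obtain N' where "reach M a N'" "only_antisymmetric_leading3 N'"
        using reach_skew[OF fin M N4 mn3(1,2) True evs left(1,2) N4c2 out] by blast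
      thus ?thesis using that by blast
    qed
  qed
qed

section \<open>Jacobian matrices\<close>

lemma lookup_partial_deriv:
  fixes p :: "('v, 'k::comm_semiring_1) mpol"
  shows "Poly_Mapping.lookup (partial_deriv v p) u =
    of_nat (Poly_Mapping.lookup u v + 1) * Poly_Mapping.lookup p (u + Poly_Mapping.single v 1)"
proof -
  let ?l = "Poly_Mapping.lookup" and ?e = "Poly_Mapping.single v (1::nat)"
  have "(?l (Poly_Mapping.single (t - ?e) (of_nat (?l t v) * ?l p t)) u :: 'k) =
      (if t = u + ?e then of_nat (?l u v + 1) * ?l p (u + ?e) else 0)" for t
  proof (cases "?l t v = 0")
    case True
    hence "t \<noteq> u + ?e" by (auto simp: lookup_add)
    thus ?thesis using True by (simp add: lookup_single)
  next
    case False
    hence "t - ?e = u \<longleftrightarrow> t = u + ?e"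
      by (auto simp: poly_mapping_eq_iff fun_eq_iff lookup_add lookup_minus lookup_single when_def)
    thus ?thesis by (auto simp: lookup_single lookup_add)
  qed
  hence "?l (partial_deriv v p) u =
      (\<Sum>t\<in>Poly_Mapping.keys p. if t = u + ?e then of_nat (?l u v + 1) * ?l p (u + ?e) else 0)"
    unfolding partial_deriv_def lookup_sum by (intro sum.cong) auto
  thus ?thesis by (auto simp: in_keys_iff)
qed

lemma two_neq_0_iff_CHAR: "(2::'k::field) \<noteq> 0 \<longleftrightarrow> CHAR('k) \<noteq> 2"
proof -
  have "(2::'k) = 0 \<longleftrightarrow> CHAR('k) dvd 2"
    using of_nat_eq_0_iff_char_dvd[where 'a = 'k, of 2] by simp
  also have "\<dots> \<longleftrightarrow> CHAR('k) = 2"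
  proof
    assume dvd: "CHAR('k) dvd 2"
    hence "CHAR('k) \<le> 2" "CHAR('k) \<noteq> 0" by (auto dest: dvd_imp_le intro!: Nat.gr0I)
    thus "CHAR('k) = 2" using CHAR_not_1[where 'a = 'k] by linarith
  qed simp
  finally show ?thesis by blast
qed

text \<open>\<open>b l\<close> is the direction given by column \<open>l\<close> of
  \<open>T\<close>, so on affine polynomials \<open>ev (b l)\<close> is a directional derivative.
  The first two facts express that second derivatives at the origin are symmetric, and that the pure
  ones vanish in characteristic 2. The third holds because the columns of \<open>T\<close> span all
  directions.\<close>

lemma jacobian_derivations:
  fixes M :: "('v, 'k::field) mpol mat" and x :: "nat \<Rightarrow> 'v"
  assumes x: "bij_betw x {..<n} UNIV" and M: "M \<in> carrier_mat m n"
    and jac: "is_jacobian_mat x M" and eq: "equivalent_over_K M N"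
  obtains b where
    "\<And>i j l. i < m \<Longrightarrow> j < n \<Longrightarrow> l < n \<Longrightarrow> ev (b l) (N $$ (i, j)) = ev (b j) (N $$ (i, l))"
    "\<And>i j. CHAR('k) = 2 \<Longrightarrow> i < m \<Longrightarrow> j < n \<Longrightarrow> ev (b j) (N $$ (i, j)) = 0"
    "\<And>p. aff p \<Longrightarrow> \<forall>l<n. ev (b l) p = 0 \<Longrightarrow> \<exists>c. p = const_mpol c"
proof -
  let ?e = "\<lambda>k. Poly_Mapping.single (x k) (1::nat)"
  obtain S T where S: "S \<in> carrier_mat m m"
    and T: "T \<in> carrier_mat n n" "invertible_mat T"
    and N: "N = map_mat const_mpol S * M * map_mat const_mpol T"
    using eq M unfolding equivalent_over_K_def by (metis carrier_matD)
  obtain H where H: "H \<in> carrier_vec m" "M = jacobian_mat x n H"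
    using jac M unfolding is_jacobian_mat_def by auto
  \<comment> \<open>The coefficient of \<open>x s\<close> in \<open>M $$ (k, r)\<close>: the second
    derivative by \<open>x r\<close> and \<open>x s\<close> of component \<open>k\<close> of
    \<open>H\<close> at the origin.\<close>
  define Q where "Q k r s = Poly_Mapping.lookup (M $$ (k, r)) (?e s)" for k r s
  have xinj: "x r = x s \<longleftrightarrow> r = s" if "r < n" "s < n" for r s
    using x that by (auto simp: bij_betw_def inj_on_def)
  have Q: "Q k r s = of_nat (if r = s then 2 else 1) * Poly_Mapping.lookup (H $ k) (?e s + ?e r)"
    if "k < m" "r < n" "s < n" for k r s
    using that H xinj[OF that(2,3)] by (auto simp: Q_def jacobian_mat_def lookup_partial_deriv lookup_single)
  have Qsym: "Q k r s = Q k s r" if "k < m" "r < n" "s < n" for k r s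
    using that by (simp add: Q add.commute)
  have Qalt: "Q k r r = 0" if "CHAR('k) = 2" "k < m" "r < n" for k r
    using that of_nat_CHAR[where 'a = 'k] by (simp add: Q)
  define b where "b l = (\<lambda>t. \<Sum>s\<in>{0..<n}. T $$ (s, l) * (if t = ?e s then 1 else 0))" for l
  have b: "ev (b l) p = (\<Sum>s\<in>{0..<n}. T $$ (s, l) * Poly_Mapping.lookup p (?e s))" for l p
  proof -
    have "ev (b l) p = (\<Sum>t\<in>Poly_Mapping.keys p. \<Sum>s\<in>{0..<n}.
        T $$ (s, l) * (if t = ?e s then Poly_Mapping.lookup p (?e s) else 0))"
      unfolding ev_def b_def sum_distrib_right by (intro sum.cong) auto
    also have "\<dots> = (\<Sum>s\<in>{0..<n}. \<Sum>t\<in>Poly_Mapping.keys p.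
        T $$ (s, l) * (if t = ?e s then Poly_Mapping.lookup p (?e s) else 0))"
      by (rule sum.swap)
    also have "\<dots> = (\<Sum>s\<in>{0..<n}. T $$ (s, l) * Poly_Mapping.lookup p (?e s))"
      by (rule sum.cong) (auto simp: in_keys_iff simp flip: sum_distrib_left)
    finally show ?thesis .
  qed
  \<comment> \<open>The bilinear forms \<open>Q k\<close>, evaluated at columns \<open>j\<close> and
    \<open>l\<close> of \<open>T\<close> and combined by row \<open>i\<close> of
    \<open>S\<close>.\<close>
  have ent: "ev (b l) (N $$ (i, j)) =
    (\<Sum>k\<in>{0..<m}. S $$ (i, k) * (\<Sum>r\<in>{0..<n}. \<Sum>s\<in>{0..<n}. T $$ (r, j) * T $$ (s, l) * Q k r s))"
    if "i < m" "j < n" for i j l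
  proof -
    have "N $$ (i, j) = (\<Sum>r\<in>{0..<n}. (\<Sum>k\<in>{0..<m}. const_mpol (S $$ (i, k)) * M $$ (k, r)) * const_mpol (T $$ (r, j)))"
      using that S T M by (simp add: N scalar_prod_def del: assoc_mult_mat)
    also have "\<dots> = (\<Sum>r\<in>{0..<n}. \<Sum>k\<in>{0..<m}. const_mpol (S $$ (i, k) * T $$ (r, j)) * M $$ (k, r))"
      unfolding sum_distrib_right by (simp add: const_mpol_mult mult_ac)
    also have "ev (b l) \<dots> = (\<Sum>r\<in>{0..<n}. \<Sum>k\<in>{0..<m}. S $$ (i, k) * T $$ (r, j) * ev (b l) (M $$ (k, r)))"
      by (simp add: ev_sum ev_const_mult)
    also have "\<dots> = (\<Sum>k\<in>{0..<m}. \<Sum>r\<in>{0..<n}. S $$ (i, k) * T $$ (r, j) * ev (b l) (M $$ (k, r)))"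
      by (rule sum.swap)
    also have "\<dots> = (\<Sum>k\<in>{0..<m}. S $$ (i, k) * (\<Sum>r\<in>{0..<n}. \<Sum>s\<in>{0..<n}. T $$ (r, j) * T $$ (s, l) * Q k r s))"
      by (simp add: b Q_def sum_distrib_left mult.assoc)
    finally show ?thesis .
  qed
  show thesis
  proof (rule that)
    fix i j l assume ijl: "i < m" "j < n" "l < n"
    have "(\<Sum>r\<in>{0..<n}. \<Sum>s\<in>{0..<n}. T $$ (r, j) * T $$ (s, l) * Q k r s) =
      (\<Sum>r\<in>{0..<n}. \<Sum>s\<in>{0..<n}. T $$ (r, l) * T $$ (s, j) * Q k r s)" if "k < m" for k
      by (subst sum.swap, intro sum.cong refl) (use that Qsym in auto)
    thus "ev (b l) (N $$ (i, j)) = ev (b j) (N $$ (i, l))"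
      using ijl by (simp add: ent)
  next
    fix i j assume char: "CHAR('k) = 2" and ij: "i < m" "j < n"
    have two: "(2::'k) = 0" using char two_neq_0_iff_CHAR[where 'k = 'k] by blast
    \<comment> \<open>In characteristic 2 a symmetric form with zero diagonal is alternating, so it
      vanishes when both arguments are column \<open>j\<close> of \<open>T\<close>.\<close>
    have "(\<Sum>r\<in>{0..<n}. \<Sum>s\<in>{0..<n}. T $$ (r, j) * T $$ (s, j) * Q k r s) = 0" if "k < m" for k
    proof (rule sum_alternating_eq_0)
      fix r s assume "r \<in> {0..<n}" "s \<in> {0..<n}"
      thus "T $$ (r, j) * T $$ (s, j) * Q k r s + T $$ (s, j) * T $$ (r, j) * Q k s r = 0"
        using Qsym[OF that, of r s] two by (simp add: mult.commute)
    qed (use that Qalt char in auto)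
    thus "ev (b j) (N $$ (i, j)) = 0" using ij by (simp add: ent)
  next
    fix p :: "('v, 'k) mpol" assume p: "aff p" and z: "\<forall>l<n. ev (b l) p = 0"
    obtain T' where T': "T' \<in> carrier_mat n n" "T * T' = 1\<^sub>m n"
      using invertible_mat_iff[OF T(1)] T(2) by blast
    have coeff: "Poly_Mapping.lookup p (?e k) = 0" if k: "k < n" for k
    proof -
      \<comment> \<open>The inverse of \<open>T\<close> expresses the derivative by
        \<open>x k\<close> through the directions \<open>b l\<close>.\<close>
      have "0 = (\<Sum>l\<in>{0..<n}. ev (b l) p * T' $$ (l, k))" by (simp add: z)
      also have "\<dots> = (\<Sum>l\<in>{0..<n}. \<Sum>s\<in>{0..<n}. Poly_Mapping.lookup p (?e s) * (T $$ (s, l) * T' $$ (l, k)))"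
        unfolding b sum_distrib_right by (simp add: mult_ac)
      also have "\<dots> = (\<Sum>s\<in>{0..<n}. \<Sum>l\<in>{0..<n}. Poly_Mapping.lookup p (?e s) * (T $$ (s, l) * T' $$ (l, k)))"
        by (rule sum.swap)
      also have "\<dots> = (\<Sum>s\<in>{0..<n}. Poly_Mapping.lookup p (?e s) * (T * T') $$ (s, k))"
        using T(1) T'(1) k by (simp add: scalar_prod_def sum_distrib_left)
      also have "\<dots> = (\<Sum>s\<in>{0..<n}. if s = k then Poly_Mapping.lookup p (?e k) else 0)"
        unfolding T'(2) using k by (intro sum.cong) auto
      also have "\<dots> = Poly_Mapping.lookup p (?e k)" using k by simp
      finally show ?thesis ..
    qed
    have zero: "Poly_Mapping.lookup p t = 0" if t: "t \<noteq> 0" for t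
    proof (cases "t \<in> aff_exps")
      case True
      then obtain v where v: "t = Poly_Mapping.single v 1" using t unfolding aff_exps_def by blast
      have "v \<in> x ` {..<n}" using x by (simp add: bij_betw_def)
      thus ?thesis using coeff v by auto
    qed (use p in \<open>simp add: aff_iff\<close>)
    have "p = const_mpol (Poly_Mapping.lookup p 0)"
      unfolding const_mpol_def by (rule poly_mapping_eqI) (simp add: lookup_single when_def zero)
    thus "\<exists>c. p = const_mpol c" ..
  qed
qed

text \<open>On the leading block, \<open>ev (b l) (N $$ (i, j))\<close> is antisymmetric in
  \<open>i\<close>, \<open>j\<close> and symmetric in \<open>j\<close>, \<open>l\<close>. Applying
  both rules in turn to the indices 0, 1, 2 leads back to the start with the opposite sign, so
  \<open>s = - s\<close>. If 2 were nonzero, two entries of the block would then be constant,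
  against linear independence.\<close>

lemma antisymmetric_jacobian_char_2:
  fixes N :: "('v, 'k::field) mpol mat"
  assumes N: "N \<in> carrier_mat m n" and anti: "only_antisymmetric_leading3 N"
    and aff: "\<And>i j. i < m \<Longrightarrow> j < n \<Longrightarrow> aff (N $$ (i, j))"
    and sym: "\<And>i j l. i < m \<Longrightarrow> j < n \<Longrightarrow> l < n \<Longrightarrow> ev (b l) (N $$ (i, j)) = ev (b j) (N $$ (i, l))"
    and const: "\<And>p. aff p \<Longrightarrow> \<forall>l<n. ev (b l) p = 0 \<Longrightarrow> \<exists>c. p = const_mpol c"
  shows "CHAR('k) = 2" "symmetric_mat (leading3 N)"
proof -
  have mn: "3 \<le> m" "3 \<le> n" and at: "transpose_mat (leading3 N) = - leading3 N"
    and diag: "\<And>i. i < 3 \<Longrightarrow> N $$ (i, i) = 0"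
    and out: "\<And>i j. i < m \<Longrightarrow> j < n \<Longrightarrow> \<not> (i < 3 \<and> j < 3) \<Longrightarrow> N $$ (i, j) = 0"
    and indep: "lin_indep3 (N $$ (1, 0)) (N $$ (2, 0)) (N $$ (2, 1))"
    using anti N by (auto simp: only_antisymmetric_leading3_def antisymmetric_mat_def leading3_def)
  have lt: "0 < m" "1 < m" "2 < m" "0 < n" "1 < n" "2 < n" using mn by auto
  have neg: "N $$ (j, i) = - N $$ (i, j)" if "i < 3" "j < 3" for i j
    using arg_cong[OF at, of "\<lambda>A. A $$ (i, j)"] that by (simp add: leading3_def)
  have neg': "ev (b l) (N $$ (j, i)) = - ev (b l) (N $$ (i, j))" if "i < 3" "j < 3" for i j l
    using neg[OF that] by (simp add: ev_uminus)
  have cases3: "l = 0 \<or> l = 1 \<or> l = 2 \<or> (3 \<le> l \<and> l < n)" if "l < n" for l using that by auto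
  define s where "s = ev (b 2) (N $$ (1, 0))"
  have c1: "ev (b 1) (N $$ (2, 0)) = s"
    using sym[OF lt(1) lt(5,6)] neg'[of 0 1 2] neg'[of 0 2 1] by (simp add: s_def)
  have c2: "ev (b 0) (N $$ (2, 1)) = s"
    using sym[OF lt(3) lt(4,5)] c1 by simp
  have c3: "s = - s"
    using sym[OF lt(2) lt(4,6)] neg'[of 1 2 0] neg'[of 2 1 0] c2 by (simp add: s_def)
  show char: "CHAR('k) = 2"
  proof (rule ccontr)
    assume "CHAR('k) \<noteq> 2"
    hence "(2::'k) \<noteq> 0" by (simp add: two_neq_0_iff_CHAR)
    moreover have "2 * s = 0" using c3 by (metis add.right_inverse mult_2)
    ultimately have s0: "s = 0" by simp
    have "ev (b l) (N $$ (1, 0)) = 0" if "l < n" for l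
      using cases3[OF that]
    proof (elim disjE conjE)
      assume "l = 0" thus ?thesis using sym[OF lt(1) lt(4,5)] neg'[of 0 1 0] diag[of 0] by simp
    next
      assume "l = 1" thus ?thesis using sym[OF lt(2) lt(4,5)] diag[of 1] by simp
    next
      assume "l = 2" thus ?thesis using s0 by (simp add: s_def)
    next
      assume "3 \<le> l" thus ?thesis using sym[OF lt(2) lt(4) that] out[OF lt(2) that] by simp
    qed
    then obtain c where c: "N $$ (1, 0) = const_mpol c" using const[OF aff[OF lt(2,4)]] by blast
    have "ev (b l) (N $$ (2, 0)) = 0" if "l < n" for l
      using cases3[OF that]
    proof (elim disjE conjE)
      assume "l = 0" thus ?thesis using sym[OF lt(1) lt(4,6)] neg'[of 0 2 0] diag[of 0] by simp
    next
      assume "l = 1" thus ?thesis using s0 c1 by simp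
    next
      assume "l = 2" thus ?thesis using sym[OF lt(3) lt(4,6)] diag[of 2] by simp
    next
      assume "3 \<le> l" thus ?thesis using sym[OF lt(3) lt(4) that] out[OF lt(3) that] by simp
    qed
    then obtain d where d: "N $$ (2, 0) = const_mpol d" using const[OF aff[OF lt(3,4)]] by blast
    have rel: "const_mpol u * N $$ (1, 0) + const_mpol v * N $$ (2, 0) + const_mpol 0 * N $$ (2, 1) = 0 \<Longrightarrow>
      u = 0 \<and> v = 0" for u v
      using indep unfolding lin_indep3_def by blast
    \<comment> \<open>A crosswise relation between the constants \<open>c\<close> and
      \<open>d\<close>. If its coefficients are zero, then \<open>N $$ (1, 0)\<close> is zero, again
      against independence.\<close>
    have "const_mpol d * N $$ (1, 0) + const_mpol (- c) * N $$ (2, 0) + const_mpol 0 * N $$ (2, 1) = 0"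
      unfolding c d by (simp add: const_mpol_uminus mult.commute)
    hence "c = 0" using rel[of d "- c"] by simp
    hence "N $$ (1, 0) = 0" unfolding c by simp
    thus False using rel[of 1 0] by simp
  qed
  have "- p = p" for p :: "('v, 'k) mpol"
  proof -
    have "(2::'k) = 0" using char two_neq_0_iff_CHAR[where 'k = 'k] by blast
    hence "const_mpol (1 + 1) * p = 0" by simp
    hence "p + p = 0" unfolding const_mpol_add by (simp add: algebra_simps)
    thus ?thesis by (simp add: neg_eq_iff_add_eq_0)
  qed
  hence "- leading3 N = leading3 N"
    by (intro eq_matI) (auto simp: leading3_def)
  thus "symmetric_mat (leading3 N)" using at by (simp add: symmetric_mat_def)
qed

text \<open>By symmetry, the entries of column 0 below the first row have zero derivative along
  \<open>b l\<close> for \<open>l >= 1\<close>, so the derivative along \<open>b 0\<close>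
  determines each of them up to a constant. Clearing with one row leaves constants further down;
  clearing with a second row leaves at most one of these.\<close>

lemma reach_first_col_half:
  fixes M :: "('v::linorder, 'k::field) mpol mat"
  assumes M: "M \<in> carrier_mat m n" and N: "reach M a N" and cross: "only_first_row_and_col N"
    and sym: "\<And>i j l. i < m \<Longrightarrow> j < n \<Longrightarrow> l < n \<Longrightarrow> ev (b l) (N $$ (i, j)) = ev (b j) (N $$ (i, l))"
    and alt: "\<And>i j. CHAR('k) = 2 \<Longrightarrow> i < m \<Longrightarrow> j < n \<Longrightarrow> ev (b j) (N $$ (i, j)) = 0"
    and const: "\<And>p. aff p \<Longrightarrow> \<forall>l<n. ev (b l) p = 0 \<Longrightarrow> \<exists>c. p = const_mpol c"
  obtains N' where "reach M a N'" "only_first_two_rows N' \<or> (only_first_row_and_col N' \<and> first_col_half N')"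
proof -
  note finish = that
  have Nc: "N \<in> carrier_mat m n" using reach_carrier[OF M N] .
  have mn: "0 < m" "0 < n" and z: "\<And>i j. 1 \<le> i \<Longrightarrow> i < m \<Longrightarrow> 1 \<le> j \<Longrightarrow> j < n \<Longrightarrow> N $$ (i, j) = 0"
    using cross Nc by (auto simp: only_first_row_and_col_def)
  have affX: "\<And>i j. i < m \<Longrightarrow> j < n \<Longrightarrow> aff (X $$ (i, j))"
    and nvX: "\<not> vanish2 m n (\<lambda>i j. X $$ (i, j))" if "reach M a X" for X
    using that M by (auto simp: reach_def)
  have rows: thesis if X: "reach M a X" and m2: "2 \<le> m"
    and col0: "\<And>i. 2 \<le> i \<Longrightarrow> i < m \<Longrightarrow> X $$ (i, 0) = 0"
    and zX: "\<And>i j. 1 \<le> i \<Longrightarrow> i < m \<Longrightarrow> 1 \<le> j \<Longrightarrow> j < n \<Longrightarrow> X $$ (i, j) = 0" for X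
  proof -
    have "X $$ (i, j) = 0" if "2 \<le> i" "i < m" "j < n" for i j
      using that col0 zX[of i j] by (cases "j = 0") auto
    from only_first_two_rowsI[OF reach_carrier[OF M X] m2 nvX[OF X] this] show thesis
      using finish[OF X] by blast
  qed
  have bl: "ev (b l) (N $$ (i, 0)) = 0" if "1 \<le> i" "i < m" "1 \<le> l" "l < n" for i l
    using sym[OF that(2) mn(2) that(4)] z[OF that] by simp
  show thesis
  proof (cases "\<forall>i. 1 \<le> i \<longrightarrow> i < m \<longrightarrow> ev (b 0) (N $$ (i, 0)) = 0")
    case True
    have "\<exists>c. N $$ (i, 0) = const_mpol c" if i: "1 \<le> i" "i < m" for i
    proof (intro const[OF affX[OF N i(2) mn(2)]] allI impI)
      fix l assume "l < n"
      thus "ev (b l) (N $$ (i, 0)) = 0" using True bl[OF i, of l] i by (cases "l = 0") auto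
    qed
    then obtain \<kappa> where \<kappa>: "\<And>i. 1 \<le> i \<Longrightarrow> i < m \<Longrightarrow> N $$ (i, 0) = const_mpol (\<kappa> i)" by metis
    \<comment> \<open>Otherwise the first row would be the only nonzero one, and all 2x2 minors
      would vanish.\<close>
    have "\<exists>r. 1 \<le> r \<and> r < m \<and> \<kappa> r \<noteq> 0"
    proof (rule ccontr)
      assume no: "\<not> ?thesis"
      have "vanish2 m n (\<lambda>i j. N $$ (i, j))"
      proof (rule vanish2_single_row[of m n 0])
        fix i j assume ij: "i < m" "j < n" "i \<noteq> 0"
        hence "\<kappa> i = 0" using no by auto
        thus "N $$ (i, j) = 0" using ij z[of i j] \<kappa>[of i] by (cases "j = 0") auto
      qed
      thus False using nvX[OF N] by blast
    qed
    then obtain r where r: "1 \<le> r" "r < m" "\<kappa> r \<noteq> 0" by blast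
    define \<sigma> where "\<sigma> = id(1 := r, r := 1)"
    have \<sigma>: "\<And>i. i < m \<Longrightarrow> \<sigma> i < m" "\<And>i. i < m \<Longrightarrow> \<sigma> (\<sigma> i) = i" "\<And>i. 1 \<le> i \<Longrightarrow> 1 \<le> \<sigma> i" "\<sigma> 1 = r"
      using r by (auto simp: \<sigma>_def)
    obtain N1 where N1: "reach M a N1" and e1: "\<And>i j. i < m \<Longrightarrow> j < n \<Longrightarrow> N1 $$ (i, j) = N $$ (\<sigma> i, j)"
      using reach_row_perm[OF M N, of \<sigma>] \<sigma> by blast
    define d where "d i = (if 2 \<le> i then - \<kappa> (\<sigma> i) / \<kappa> r else 0)" for i
    have d1: "d 1 = 0" and m1: "1 < m" using r by (auto simp: d_def)
    obtain N2 where N2: "reach M a N2" and e2: "\<And>i j. i < m \<Longrightarrow> j < n \<Longrightarrow>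
        N2 $$ (i, j) = const_mpol 1 * N1 $$ (i, j) + const_mpol (d i) * N1 $$ (1, j)"
      using reach_row_lincomb[where c = "\<lambda>_. 1" and d = d, OF M N1 _ d1 m1] by auto
    show thesis
    proof (rule rows[OF N2])
      show "2 \<le> m" using m1 by simp
      fix i assume i: "2 \<le> i" "i < m"
      have "N2 $$ (i, 0) = const_mpol (\<kappa> (\<sigma> i) + d i * \<kappa> r)"
        using i m1 mn \<sigma> \<kappa>[of "\<sigma> i"] \<kappa>[of r] r by (simp add: e1 e2 const_mpol_add const_mpol_mult)
      thus "N2 $$ (i, 0) = 0" using i r by (simp add: d_def)
    next
      fix i j assume "1 \<le> i" "i < m" "1 \<le> j" "j < n"
      thus "N2 $$ (i, j) = 0" using \<sigma> z[of "\<sigma> i" j] z[of r j] r m1 by (simp add: e1 e2)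
    qed
  next
    case False
    then obtain r where r: "1 \<le> r" "r < m" "ev (b 0) (N $$ (r, 0)) \<noteq> 0" by blast
    \<comment> \<open>In characteristic 2, the alternating property makes the derivative of column 0
      along \<open>b 0\<close> zero.\<close>
    have char: "CHAR('k) \<noteq> 2" using alt[OF _ r(2) mn(2)] r(3) by blast
    define \<sigma> where "\<sigma> = id(1 := r, r := 1)"
    have \<sigma>: "\<And>i. i < m \<Longrightarrow> \<sigma> i < m" "\<And>i. i < m \<Longrightarrow> \<sigma> (\<sigma> i) = i" "\<And>i. 1 \<le> i \<Longrightarrow> 1 \<le> \<sigma> i" "\<sigma> 1 = r"
      using r by (auto simp: \<sigma>_def)
    obtain N1 where N1: "reach M a N1" and e1: "\<And>i j. i < m \<Longrightarrow> j < n \<Longrightarrow> N1 $$ (i, j) = N $$ (\<sigma> i, j)"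
      using reach_row_perm[OF M N, of \<sigma>] \<sigma> by blast
    \<comment> \<open>Cancels the derivative along \<open>b 0\<close> in the rows from 2 on, which
      makes their entries in column 0 constant.\<close>
    define d where "d i = (if 2 \<le> i then - ev (b 0) (N $$ (\<sigma> i, 0)) / ev (b 0) (N $$ (r, 0)) else 0)" for i
    have d1: "d 1 = 0" and m1: "1 < m" using r by (auto simp: d_def)
    obtain N2 where N2: "reach M a N2" and e2: "\<And>i j. i < m \<Longrightarrow> j < n \<Longrightarrow>
        N2 $$ (i, j) = const_mpol 1 * N1 $$ (i, j) + const_mpol (d i) * N1 $$ (1, j)"
      using reach_row_lincomb[where c = "\<lambda>_. 1" and d = d, OF M N1 _ d1 m1] by auto
    have z2: "N2 $$ (i, j) = 0" if "1 \<le> i" "i < m" "1 \<le> j" "j < n" for i j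
      using that \<sigma> z[of "\<sigma> i" j] z[of r j] r m1 by (simp add: e1 e2)
    have "\<exists>c. N2 $$ (i, 0) = const_mpol c" if i: "2 \<le> i" "i < m" for i
    proof (intro const[OF affX[OF N2 i(2) mn(2)]] allI impI)
      fix l assume l: "l < n"
      have "ev (b l) (N2 $$ (i, 0)) = ev (b l) (N $$ (\<sigma> i, 0)) + d i * ev (b l) (N $$ (r, 0))"
        using i m1 mn \<sigma>(4) by (simp add: e1 e2 ev_add ev_const_mult)
      thus "ev (b l) (N2 $$ (i, 0)) = 0"
        using bl[of "\<sigma> i" l] bl[of r l] i \<sigma> r l by (cases "l = 0") (auto simp: d_def)
    qed
    then obtain \<kappa> where \<kappa>: "\<And>i. 2 \<le> i \<Longrightarrow> i < m \<Longrightarrow> N2 $$ (i, 0) = const_mpol (\<kappa> i)" by metis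
    show thesis
    proof (cases "\<forall>i. 2 \<le> i \<longrightarrow> i < m \<longrightarrow> \<kappa> i = 0")
      case True
      show thesis by (rule rows[OF N2 _ _ z2]) (use m1 True \<kappa> in auto)
    next
      case False
      then obtain t where t: "2 \<le> t" "t < m" "\<kappa> t \<noteq> 0" by blast
      define \<tau> where "\<tau> = id(2 := t, t := 2)"
      have \<tau>: "\<And>i. i < m \<Longrightarrow> \<tau> i < m" "\<And>i. i < m \<Longrightarrow> \<tau> (\<tau> i) = i"
        "\<And>i. 1 \<le> i \<Longrightarrow> 1 \<le> \<tau> i" "\<And>i. 2 \<le> i \<Longrightarrow> 2 \<le> \<tau> i" "\<tau> 2 = t"
        using t by (auto simp: \<tau>_def)
      obtain N3 where N3: "reach M a N3" and e3: "\<And>i j. i < m \<Longrightarrow> j < n \<Longrightarrow> N3 $$ (i, j) = N2 $$ (\<tau> i, j)"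
        using reach_row_perm[OF M N2, of \<tau>] \<tau> by blast
      have two: "(2::'k) \<noteq> 0" using char by (simp add: two_neq_0_iff_CHAR)
      \<comment> \<open>Normalizes the remaining constant \<open>\<kappa> t\<close> to
        \<open>1 / 2\<close>; the factor exists because 2 is nonzero here.\<close>
      define c where "c i = (if i = 2 then 1 / (2 * \<kappa> t) else 1)" for i :: nat
      define g where "g i = (if 3 \<le> i then - \<kappa> (\<tau> i) / \<kappa> t else 0)" for i
      have cg: "\<And>i. i < m \<Longrightarrow> c i \<noteq> 0" "g 2 = 0" "2 < m" using t two by (auto simp: c_def g_def)
      obtain N4 where N4: "reach M a N4" and e4: "\<And>i j. i < m \<Longrightarrow> j < n \<Longrightarrow>
          N4 $$ (i, j) = const_mpol (c i) * N3 $$ (i, j) + const_mpol (g i) * N3 $$ (2, j)"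
        using reach_row_lincomb[where c = c and d = g, OF M N3 cg] by blast
      have N4c: "N4 \<in> carrier_mat m n" using reach_carrier[OF M N4] .
      have col: "N4 $$ (i, 0) = const_mpol (c i * \<kappa> (\<tau> i) + g i * \<kappa> t)" if "2 \<le> i" "i < m" for i
        using that mn cg \<tau> \<kappa>[of "\<tau> i"] \<kappa>[of t] t by (simp add: e3 e4 const_mpol_add const_mpol_mult)
      have "N4 $$ (2, 0) = const_mpol (1 / 2)"
        using col[of 2] cg \<tau>(5) t two by (simp add: c_def)
      moreover have "N4 $$ (i, 0) = 0" if "3 \<le> i" "i < m" for i
        using col[of i] that t by (simp add: c_def g_def)
      ultimately have "first_col_half N4"
        using N4c char cg(3) by (auto simp: first_col_half_def)
      moreover have "only_first_row_and_col N4"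
      proof (rule only_first_row_and_colI[OF N4c mn nvX[OF N4]])
        fix i j assume "i < m" "j < n" "i \<noteq> 0" "j \<noteq> 0"
        thus "N4 $$ (i, j) = 0"
          using z2[of "\<tau> i" j] z2[of t j] \<tau> cg(3) t by (simp add: e3 e4)
      qed
      ultimately show thesis using finish[OF N4] by blast
    qed
  qed
qed

theorem theorem2p3:
  fixes x :: "nat \<Rightarrow> 'v::linorder"
    and m n :: nat
    and M :: "('v, 'k::field) mpol mat"
  assumes variables: "bij_betw x {..<n} UNIV"
    and M_carrier: "M \<in> carrier_mat m n"
    and M_degree: "\<forall>i < m. \<forall>j < n. total_deg (M $$ (i, j)) \<le> 1"
    and M_rank: "mpol_rank M = 2"
  shows "(\<exists>N. equivalent_over_K M N \<and>
            (only_first_two_cols N \<or>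
             only_first_two_rows N \<or>
             only_first_row_and_col N \<or>
             only_antisymmetric_leading3 N)) \<and>
         (is_jacobian_mat x M \<longrightarrow>
          (\<exists>N. equivalent_over_K M N \<and>
            (only_first_two_cols N \<or>
             only_first_two_rows N \<or>
             (only_first_row_and_col N \<and> first_col_half N) \<or>
             (only_antisymmetric_leading3 N \<and>
              symmetric_mat (leading3 N) \<and> CHAR('k) = 2))))"
proof -
  have fin: "finite (UNIV :: 'v set)"
    using variables bij_betw_finite by blast
  note minors = mpol_rank_2_minors[OF M_carrier M_rank]
  then obtain i k j l where ikjl: "i < m" "k < m" "j < n" "l < n" "minor2 (\<lambda>i j. M $$ (i, j)) i k j l \<noteq> 0"
    by (auto simp: vanish2_def)
  \<comment> \<open>The same point \<open>a\<close> is used in the whole reduction, so that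
    \<open>M\<close> itself satisfies the invariant.\<close>
  then obtain a where a: "minor2 (\<lambda>i j. ev a (M $$ (i, j))) i k j l \<noteq> 0"
    using ex_ev_minor_neq_0[of "M $$ (i, j)" "M $$ (k, l)" "M $$ (i, l)" "M $$ (k, j)"] unfolding minor2_def by blast
  have "reach M a M"
    unfolding reach_def
    using minors ikjl a M_carrier M_degree aff_if_total_deg_le_1 equivalent_over_K_refl[of M]
    by (auto simp: vanish2_def)
  then obtain N where N: "reach M a N" and shape: "only_first_two_cols N \<or> only_first_two_rows N \<or>
      only_first_row_and_col N \<or> only_antisymmetric_leading3 N"
    by (rule reach_classification[OF fin M_carrier])
  have eq: "equivalent_over_K M X" if "reach M a X" for X
    using that by (simp add: reach_def)
  have "\<exists>N. equivalent_over_K M N \<and> (only_first_two_cols N \<or> only_first_two_rows N \<or>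
      (only_first_row_and_col N \<and> first_col_half N) \<or>
      (only_antisymmetric_leading3 N \<and> symmetric_mat (leading3 N) \<and> CHAR('k) = 2))"
    if jac: "is_jacobian_mat x M"
  proof -
    obtain b where
      b: "\<And>i j l. i < m \<Longrightarrow> j < n \<Longrightarrow> l < n \<Longrightarrow> ev (b l) (N $$ (i, j)) = ev (b j) (N $$ (i, l))"
      "\<And>i j. CHAR('k) = 2 \<Longrightarrow> i < m \<Longrightarrow> j < n \<Longrightarrow> ev (b j) (N $$ (i, j)) = 0"
      "\<And>p. aff p \<Longrightarrow> \<forall>l<n. ev (b l) p = 0 \<Longrightarrow> \<exists>c. p = const_mpol c"
      by (rule jacobian_derivations[OF variables M_carrier jac eq[OF N]]) (rule that)
    consider "only_first_two_cols N \<or> only_first_two_rows N" | "only_first_row_and_col N"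
      | "only_antisymmetric_leading3 N" using shape by blast
    thus ?thesis
    proof cases
      case 1
      thus ?thesis using eq[OF N] by blast
    next
      case 2
      obtain N' where "reach M a N'" "only_first_two_rows N' \<or> (only_first_row_and_col N' \<and> first_col_half N')"
        by (rule reach_first_col_half[OF M_carrier N 2 b]) (assumption | rule that)+
      thus ?thesis using eq by blast
    next
      case 3
      have aff: "\<And>i j. i < m \<Longrightarrow> j < n \<Longrightarrow> aff (N $$ (i, j))" using N M_carrier by (simp add: reach_def)
      show ?thesis
        using antisymmetric_jacobian_char_2[OF reach_carrier[OF M_carrier N] 3 aff b(1,3)] 3 eq[OF N] by blast
    qed
  qed
  thus ?thesis using eq[OF N] shape by blast
qed

end
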